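(* Let $x_*$ be a feasible point of the semi-infinite minimax problem $$\min_x\max_{\omega\in W}f(x,\omega)\quad\text{s.t.}\quad g_i(x,t)\le0\ (t\in T,\ i\in I),\quad b(x)=0,\quad x\in A.\qquad(\mathrm{SIP})$$ Then: (1) if $x_*$ is a locally optimal solution of (SIP) at which RCQ holds, then there exists a discrete Lagrange multiplier of (SIP) at $x_*$; (2) a discrete Lagrange multiplier exists at $x_*$ if and only if for every $i\in I(x_* )$ one can find $m_i\in\{1,\dots,d+1\}$ and $t_{ij}\in T_i(x_* )$, $j=1,\dots,m_i$, such that there exists at $x_*$ a Lagrange multiplier of the discretised problem $$\min_x\max_{\omega\in W}f(x,\omega)\quad\text{s.t.}\quad g_i(x,t_{ij})\le0\ (j=1,\dots,m_i,\ i\in I(x_* )),\quad b(x)=0,\quad x\in A;\qquad(\mathrm{D})$$ (3) if $b\equiv0$, $f(\cdot,\omega)$ is convex for every $\omega\in W$, $g_i(\cdot,t)$ is convex for every $t\in T$ and $i\in I$, and there exists $x_0\in A$ with $g_i(x_0,t)<0$ for all $t\in T$, $i\in I$, then the following are equivalent: a discrete Lagrange multiplier exists at $x_*$; $x_*$ is a globally optimal solution of (SIP); for every $i\in I(x_* )$ there exist $m_i\in\{1,\dots,d+1\}$ and $t_{ij}\in T_i(x_* )$, $j=1,\dots,m_i$, such that $x_*$ is a globally optimal solution of (D).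
   Context: $A\subseteq\mathbb{R}^d$ nonempty closed convex; $W$ compact Hausdorff space; $f:\mathbb{R}^d\times W\to\mathbb{R}$ differentiable in $x$ for each $\omega$, with $f$ and $\nabla_xf$ jointly continuous; $F(x)=\max_\omega f(x,\omega)$. $b:\mathbb{R}^d\to\mathbb{R}^s$ is continuously differentiable; $T$ is a compact metric space; $I=\{1,\dots,l\}$; each $g_i:\mathbb{R}^d\times T\to\mathbb{R}$ is jointly continuous, differentiable in $x$ for each $t$, with $\nabla_xg_i$ continuous. $C(T)$ is the space of continuous functions on $T$ with the uniform norm, $C_-(T)$ its cone of nonpositive functions, $rca_+(T)$ the cone of (nonnegative) regular Borel measures on $T$. Set $Y=C(T)^l\times\mathbb{R}^s$, $K=C_-(T)^l\times\{0_s\}$, $G(x)=(g_1(x,\cdot),\dots,g_l(x,\cdot),b(x))$; RCQ at $x_*$ means $0\in\operatorname{int}\{G(x_* )+DG(x_* )(A-x_* )-K\}$ in $Y$. A Lagrange multiplier of (SIP) at feasible $x_*$ is $\lambda=(\mu_1,\dots,\mu_l,\nu)$ with $\mu_i\in rca_+(T)$, $\nu\in\mathbb{R}^s$, $\sum_i\int_Tg_i(x_*,t)\,d\mu_i(t)=0$, and $[L(\cdot,\lambda)]'(x_*,h)\ge0$ for all $h$ in the contingent cone $T_A(x_* )$, where $L(x,\lambda)=F(x)+\sum_{i=1}^l\int_Tg_i(x,t)\,d\mu_i(t)+\langle\nu,b(x)\rangle$. It is a discrete Lagrange multiplier if each $\mu_i=\sum_{j=1}^{m_i}\lambda_{ij}\delta(t_{ij})$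 with $t_{ij}\in T$, $\lambda_{ij}\ge0$, $m_i\le d+1$ ($\delta(t)$ the Dirac measure at $t$). $I(x)=\{i\in I:\max_{t\in T}g_i(x,t)=0\}$, $T_i(x)=\{t\in T:g_i(x,t)=0\}$. A Lagrange multiplier of a problem with finitely many inequality constraints $h_k(x)\le0$, equality constraints $b(x)=0$ and $x\in A$ at feasible $x_*$ is $(\lambda_k,\nu)$ with $\lambda_k\ge0$, $\lambda_kh_k(x_* )=0$ and nonnegative directional derivative of $F+\sum\lambda_kh_k+\langle\nu,b\rangle$ at $x_*$ along every $h\in T_A(x_* )$. *)

theory Defs
  imports "HOL-Analysis.Analysis"
begin

definition contingent_cone :: "'a::real_normed_vector set \<Rightarrow> 'a \<Rightarrow> 'a set" where
  "contingent_cone A x = {h. \<exists>tn hn. (\<forall>n. tn n > (0::real)) \<and> tn \<longlonglongrightarrow> 0 \<and> hn \<longlonglongrightarrow> h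
      \<and> (\<forall>n. x + tn n *\<^sub>R hn n \<in> A)}"

definition nonneg_dir_deriv :: "('a::real_normed_vector \<Rightarrow> real) \<Rightarrow> 'a \<Rightarrow> 'a \<Rightarrow> bool" where
  "nonneg_dir_deriv \<phi> x h \<longleftrightarrow>
     (\<exists>D. ((\<lambda>t. (\<phi> (x + t *\<^sub>R h) - \<phi> x) / t) \<longlongrightarrow> D) (at_right 0) \<and> D \<ge> 0)"

definition maxF :: "('a \<Rightarrow> 'w \<Rightarrow> real) \<Rightarrow> 'w set \<Rightarrow> 'a \<Rightarrow> real" where
  "maxF f W x = (SUP w\<in>W. f x w)"

definition sip_feasible ::
  "'a set \<Rightarrow> (nat \<Rightarrow> 'a \<Rightarrow> 't \<Rightarrow> real) \<Rightarrow> nat \<Rightarrow> 't set \<Rightarrow> ('a \<Rightarrow> 'b::zero) \<Rightarrow> 'a \<Rightarrow> bool" where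
  "sip_feasible A g l T b x \<longleftrightarrow> x \<in> A \<and> (\<forall>i\<in>{1..l}. \<forall>t\<in>T. g i x t \<le> 0) \<and> b x = 0"

definition sip_local_opt ::
  "('a::metric_space \<Rightarrow> 'w \<Rightarrow> real) \<Rightarrow> 'w set \<Rightarrow> 'a set \<Rightarrow> (nat \<Rightarrow> 'a \<Rightarrow> 't \<Rightarrow> real) \<Rightarrow> nat \<Rightarrow> 't set
    \<Rightarrow> ('a \<Rightarrow> 'b::zero) \<Rightarrow> 'a \<Rightarrow> bool" where
  "sip_local_opt f W A g l T b xs \<longleftrightarrow> sip_feasible A g l T b xs \<and>
     (\<exists>e>0. \<forall>x. sip_feasible A g l T b x \<and> dist x xs < e \<longrightarrow> maxF f W xs \<le> maxF f W x)"

definition sip_global_opt ::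
  "('a \<Rightarrow> 'w \<Rightarrow> real) \<Rightarrow> 'w set \<Rightarrow> 'a set \<Rightarrow> (nat \<Rightarrow> 'a \<Rightarrow> 't \<Rightarrow> real) \<Rightarrow> nat \<Rightarrow> 't set
    \<Rightarrow> ('a \<Rightarrow> 'b::zero) \<Rightarrow> 'a \<Rightarrow> bool" where
  "sip_global_opt f W A g l T b xs \<longleftrightarrow> sip_feasible A g l T b xs \<and>
     (\<forall>x. sip_feasible A g l T b x \<longrightarrow> maxF f W xs \<le> maxF f W x)"

definition active_idx :: "(nat \<Rightarrow> 'a \<Rightarrow> 't \<Rightarrow> real) \<Rightarrow> nat \<Rightarrow> 't set \<Rightarrow> 'a \<Rightarrow> nat set" where
  "active_idx g l T x = {i\<in>{1..l}. (\<exists>t\<in>T. g i x t = 0) \<and> (\<forall>t\<in>T. g i x t \<le> 0)}"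

definition active_pts :: "(nat \<Rightarrow> 'a \<Rightarrow> 't \<Rightarrow> real) \<Rightarrow> nat \<Rightarrow> 't set \<Rightarrow> 'a \<Rightarrow> 't set" where
  "active_pts g i T x = {t\<in>T. g i x t = 0}"

text \<open>Nonnegative finite Borel measures on the compact metric space T
  (on a compact metric space every such measure is regular).\<close>
definition rca_plus :: "'t::metric_space set \<Rightarrow> 't measure \<Rightarrow> bool" where
  "rca_plus T \<mu> \<longleftrightarrow> sets \<mu> = sets (restrict_space borel T) \<and> emeasure \<mu> T < \<infinity>"

definition sip_lagrangian ::
  "('a \<Rightarrow> 'w \<Rightarrow> real) \<Rightarrow> 'w set \<Rightarrow> (nat \<Rightarrow> 'a \<Rightarrow> 't \<Rightarrow> real) \<Rightarrow> nat \<Rightarrow> ('a \<Rightarrow> 'b::real_inner)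
    \<Rightarrow> (nat \<Rightarrow> 't measure) \<Rightarrow> 'b \<Rightarrow> 'a \<Rightarrow> real" where
  "sip_lagrangian f W g l b \<mu> \<nu> x =
     maxF f W x + (\<Sum>i=1..l. integral\<^sup>L (\<mu> i) (g i x)) + inner \<nu> (b x)"

definition sip_lagrange_mult ::
  "('a::real_normed_vector \<Rightarrow> 'w \<Rightarrow> real) \<Rightarrow> 'w set \<Rightarrow> 'a set \<Rightarrow> (nat \<Rightarrow> 'a \<Rightarrow> 't::metric_space \<Rightarrow> real)
    \<Rightarrow> nat \<Rightarrow> 't set \<Rightarrow> ('a \<Rightarrow> 'b::real_inner) \<Rightarrow> 'a \<Rightarrow> (nat \<Rightarrow> 't measure) \<Rightarrow> 'b \<Rightarrow> bool" where
  "sip_lagrange_mult f W A g l T b xs \<mu> \<nu> \<longleftrightarrow>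
     (\<forall>i\<in>{1..l}. rca_plus T (\<mu> i)) \<and>
     (\<Sum>i=1..l. integral\<^sup>L (\<mu> i) (g i xs)) = 0 \<and>
     (\<forall>h\<in>contingent_cone A xs. nonneg_dir_deriv (sip_lagrangian f W g l b \<mu> \<nu>) xs h)"

definition is_discrete_meas :: "'t::metric_space set \<Rightarrow> 't measure \<Rightarrow> nat \<Rightarrow> (nat \<Rightarrow> 't) \<Rightarrow> (nat \<Rightarrow> real) \<Rightarrow> bool" where
  "is_discrete_meas T \<mu> m pts lam \<longleftrightarrow>
     (\<forall>j<m. pts j \<in> T \<and> lam j \<ge> 0) \<and>
     (\<forall>S\<in>sets \<mu>. emeasure \<mu> S = (\<Sum>j<m. ennreal (lam j) * indicator S (pts j)))"

definition sip_discrete_lagrange_mult ::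
  "('a::euclidean_space \<Rightarrow> 'w \<Rightarrow> real) \<Rightarrow> 'w set \<Rightarrow> 'a set \<Rightarrow> (nat \<Rightarrow> 'a \<Rightarrow> 't::metric_space \<Rightarrow> real)
    \<Rightarrow> nat \<Rightarrow> 't set \<Rightarrow> ('a \<Rightarrow> 'b::real_inner) \<Rightarrow> 'a \<Rightarrow> (nat \<Rightarrow> 't measure) \<Rightarrow> 'b \<Rightarrow> bool" where
  "sip_discrete_lagrange_mult f W A g l T b xs \<mu> \<nu> \<longleftrightarrow>
     sip_lagrange_mult f W A g l T b xs \<mu> \<nu> \<and>
     (\<forall>i\<in>{1..l}. \<exists>m pts lam. m \<le> DIM('a) + 1 \<and> is_discrete_meas T (\<mu> i) m pts lam)"

text \<open>Robinson constraint qualification at xs, unfolded in Y = C(T)^l x R^s with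
  the uniform norm: 0 is an interior point of G(xs) + DG(xs)(A - xs) - K.
  gx i x t is the gradient of g_i(.,t) at x, Db x the derivative of b at x.\<close>
definition sip_RCQ ::
  "'a::real_inner set \<Rightarrow> (nat \<Rightarrow> 'a \<Rightarrow> 't::metric_space \<Rightarrow> real) \<Rightarrow> (nat \<Rightarrow> 'a \<Rightarrow> 't \<Rightarrow> 'a) \<Rightarrow> nat \<Rightarrow> 't set
    \<Rightarrow> ('a \<Rightarrow> 'b::real_normed_vector) \<Rightarrow> ('a \<Rightarrow> 'a \<Rightarrow>\<^sub>L 'b) \<Rightarrow> 'a \<Rightarrow> bool" where
  "sip_RCQ A g gx l T b Db xs \<longleftrightarrow>
     (\<exists>e>0. \<forall>(y::nat \<Rightarrow> 't \<Rightarrow> real) (z::'b).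
        (\<forall>i\<in>{1..l}. continuous_on T (y i) \<and> (\<forall>t\<in>T. \<bar>y i t\<bar> < e)) \<and> norm z < e \<longrightarrow>
        (\<exists>a\<in>A. (\<forall>i\<in>{1..l}. \<forall>t\<in>T. g i xs t + inner (gx i xs t) (a - xs) - y i t \<le> 0) \<and>
               b xs + blinfun_apply (Db xs) (a - xs) = z))"

definition disc_idx :: "nat set \<Rightarrow> (nat \<Rightarrow> nat) \<Rightarrow> (nat \<times> nat) set" where
  "disc_idx Iact m = {(i,j). i \<in> Iact \<and> j \<in> {1..m i}}"

definition disc_feasible ::
  "'a set \<Rightarrow> (nat \<Rightarrow> 'a \<Rightarrow> 't \<Rightarrow> real) \<Rightarrow> nat set \<Rightarrow> (nat \<Rightarrow> nat) \<Rightarrow> (nat \<Rightarrow> nat \<Rightarrow> 't)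
    \<Rightarrow> ('a \<Rightarrow> 'b::zero) \<Rightarrow> 'a \<Rightarrow> bool" where
  "disc_feasible A g Iact m tt b x \<longleftrightarrow>
     x \<in> A \<and> (\<forall>(i,j)\<in>disc_idx Iact m. g i x (tt i j) \<le> 0) \<and> b x = 0"

definition disc_global_opt ::
  "('a \<Rightarrow> 'w \<Rightarrow> real) \<Rightarrow> 'w set \<Rightarrow> 'a set \<Rightarrow> (nat \<Rightarrow> 'a \<Rightarrow> 't \<Rightarrow> real) \<Rightarrow> nat set \<Rightarrow> (nat \<Rightarrow> nat)
    \<Rightarrow> (nat \<Rightarrow> nat \<Rightarrow> 't) \<Rightarrow> ('a \<Rightarrow> 'b::zero) \<Rightarrow> 'a \<Rightarrow> bool" where
  "disc_global_opt f W A g Iact m tt b xs \<longleftrightarrow> disc_feasible A g Iact m tt b xs \<and>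
     (\<forall>x. disc_feasible A g Iact m tt b x \<longrightarrow> maxF f W xs \<le> maxF f W x)"

definition disc_lagrange_mult ::
  "('a::real_normed_vector \<Rightarrow> 'w \<Rightarrow> real) \<Rightarrow> 'w set \<Rightarrow> 'a set \<Rightarrow> (nat \<Rightarrow> 'a \<Rightarrow> 't \<Rightarrow> real) \<Rightarrow> nat set
    \<Rightarrow> (nat \<Rightarrow> nat) \<Rightarrow> (nat \<Rightarrow> nat \<Rightarrow> 't) \<Rightarrow> ('a \<Rightarrow> 'b::real_inner) \<Rightarrow> 'a
    \<Rightarrow> (nat \<times> nat \<Rightarrow> real) \<Rightarrow> 'b \<Rightarrow> bool" where
  "disc_lagrange_mult f W A g Iact m tt b xs lam \<nu> \<longleftrightarrow>
     (\<forall>(i,j)\<in>disc_idx Iact m. lam (i,j) \<ge> 0 \<and> lam (i,j) * g i xs (tt i j) = 0) \<and>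
     (\<forall>h\<in>contingent_cone A xs. nonneg_dir_deriv
        (\<lambda>x. maxF f W x + (\<Sum>(i,j)\<in>disc_idx Iact m. lam (i,j) * g i x (tt i j)) + inner \<nu> (b x)) xs h)"

definition disc_choice ::
  "nat \<Rightarrow> (nat \<Rightarrow> 'a \<Rightarrow> 't \<Rightarrow> real) \<Rightarrow> nat \<Rightarrow> 't set \<Rightarrow> 'a \<Rightarrow> (nat \<Rightarrow> nat) \<Rightarrow> (nat \<Rightarrow> nat \<Rightarrow> 't) \<Rightarrow> bool" where
  "disc_choice d g l T xs m tt \<longleftrightarrow>
     (\<forall>i\<in>active_idx g l T xs. m i \<in> {1..d+1} \<and> (\<forall>j\<in>{1..m i}. tt i j \<in> active_pts g i T xs))"

end

theory Submission
  imports Defs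
begin

text \<open>
  In the first-order analysis the objective enters as the additional constraint
  \<open>f x w - maxF f W xs \<le> 0\<close>, \<open>w \<in> W\<close>, and everything happens in finite dimension.
  At a local optimum no \<open>h\<close> with \<open>xs + h \<in> A\<close> and \<open>B h = 0\<close> (\<open>B\<close> the derivative of \<open>b\<close>)
  makes all linearised constraints strictly negative: the compact families would decrease uniformly along
  \<open>xs + t h\<close>, and Brouwer's theorem, applied with a continuous right inverse of \<open>B\<close> with values in
  the cone of \<open>A - xs\<close>, restores \<open>b = 0\<close> by an \<open>o(t)\<close> correction inside \<open>A\<close>.
  Hence the convex hull of all pairs (gradient, value) cannot be separated from the closed cone of affine functions that
  are nonnegative on \<open>A - xs\<close> up to a multiple of \<open>B\<close>. In a common point the values vanish, so only
  active indices contribute, the Slater point forces positive weight on \<open>f\<close>, and Caratheodory's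
  theorem for each gradient hull gives \<open>d + 1\<close> points per constraint.

  In the convex case \<open>b = 0\<close> makes RCQ fail, as the codomain of \<open>b\<close> is nontrivial; there the
  restoration step and the closedness of the cone are immediate.
\<close>

lemma continuous_on_section:
  assumes "continuous_on (UNIV \<times> W) (\<lambda>(x,w). f x w)"
  shows "continuous_on W (f x)"
proof -
  have "continuous_on W ((\<lambda>(x,w). f x w) \<circ> Pair x)"
    by (rule continuous_on_compose[OF _ continuous_on_subset[OF assms]]) (auto intro!: continuous_intros)
  then show ?thesis by (simp add: o_def)
qed

subsection \<open>Maxima over compact families\<close>

text \<open>Compactness of \<open>W\<close> makes the gradients near \<open>x\<close> close to those
  at \<open>x\<close> uniformly in \<open>w\<close>. The mean value inequality along the segment
  from \<open>x\<close> to \<open>x + k\<close> then yields one radius \<open>d\<close> for the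
  whole family.\<close>

lemma uniform_derivative_bound:
  fixes f :: "'a::euclidean_space \<Rightarrow> 'w::topological_space \<Rightarrow> real" and f' :: "'a \<Rightarrow> 'w \<Rightarrow> 'a"
  assumes W: "compact W"
    and deriv: "\<And>x w. w \<in> W \<Longrightarrow> ((\<lambda>x. f x w) has_derivative (\<lambda>h. inner (f' x w) h)) (at x)"
    and cont: "continuous_on (UNIV \<times> W) (\<lambda>(x,w). f' x w)"
    and e: "e > 0"
  obtains d where "d > 0"
    "\<And>k w. w \<in> W \<Longrightarrow> norm k < d \<Longrightarrow> \<bar>f (x + k) w - f x w - inner (f' x w) k\<bar> \<le> e * norm k"
proof -
  obtain X where X: "x \<in> X" "open X"
    and close: "\<forall>y\<in>X \<inter> UNIV. \<forall>w\<in>W. dist ((\<lambda>(x,w). f' x w) (y, w)) ((\<lambda>(x,w). f' x w) (x, w)) \<le> e"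
    using continuous_on_prod_compactE[OF cont W UNIV_I e, of x] by blast
  obtain d where d: "d > 0" "ball x d \<subseteq> X"
    using X open_contains_ball by metis
  have "\<bar>f (x + k) w - f x w - inner (f' x w) k\<bar> \<le> e * norm k" if w: "w \<in> W" and k: "norm k < d" for k w
  proof -
    have "norm (f (x + k) w - f x w - inner (f' x w) (x + k - x)) \<le> norm (x + k - x) * e"
    proof (rule differentiable_bound_linearization[where S = "ball x d" and f = "\<lambda>x. f x w" and f' = "\<lambda>x h. inner (f' x w) h"])
      show "x + t *\<^sub>R (x + k - x) \<in> ball x d" if t: "t \<in> {0..1}" for t
      proof -
        have "\<bar>t\<bar> * norm k \<le> 1 * norm k" using t by (intro mult_right_mono) auto
        then show ?thesis using k by (simp add: dist_norm)
      qed
      show "((\<lambda>x. f x w) has_derivative (\<lambda>h. inner (f' y w) h)) (at y within ball x d)" for y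
        using deriv[OF w] has_derivative_at_withinI by blast
      show "onorm ((\<lambda>h. inner (f' y w) h) - (\<lambda>h. inner (f' x w) h)) \<le> e" if "y \<in> ball x d" for y
      proof (rule onorm_le)
        fix h :: 'a
        have "dist (f' y w) (f' x w) \<le> e" using close d that w by fastforce
        then have "norm (f' y w - f' x w) * norm h \<le> e * norm h"
          by (intro mult_right_mono) (auto simp: dist_norm)
        then show "norm (((\<lambda>h. inner (f' y w) h) - (\<lambda>h. inner (f' x w) h)) h) \<le> e * norm h"
          using Cauchy_Schwarz_ineq2[of "f' y w - f' x w" h] by (simp add: inner_diff_left)
      qed
      show "x \<in> ball x d" using d by simp
    qed
    then show ?thesis by (simp add: mult.commute)
  qed
  then show ?thesis using that d by blast
qed

lemma maxF_upper:
  assumes "compact W" "continuous_on W (f x)" "w \<in> W"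
  shows "f x w \<le> maxF f W x"
  unfolding maxF_def
  by (rule cSUP_upper[OF assms(3)])
    (intro compact_imp_bounded[THEN bounded_imp_bdd_above] compact_continuous_image assms)

lemma maxF_attained:
  assumes "compact W" "W \<noteq> {}" "continuous_on W (f x)"
  obtains w where "w \<in> W" "f x w = maxF f W x"
proof -
  obtain w where w: "w \<in> W" "\<forall>v\<in>W. f x v \<le> f x w"
    using continuous_attains_sup[OF assms] by blast
  have "maxF f W x \<le> f x w"
    unfolding maxF_def by (rule cSUP_least) (use assms w in auto)
  with maxF_upper[of W f x w] assms w have "f x w = maxF f W x" by force
  with w that show ?thesis by blast
qed

text \<open>Danskin's theorem: the limit \<open>D\<close> is the largest slope among the maximisers
  at \<open>x\<close>. Its existence and its domination of all these slopes are what the first-order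
  condition draws on.\<close>

lemma maxF_dir_deriv:
  fixes f :: "'a::euclidean_space \<Rightarrow> 'w::t2_space \<Rightarrow> real" and f' :: "'a \<Rightarrow> 'w \<Rightarrow> 'a"
  assumes W: "compact W" "W \<noteq> {}"
    and f_cont: "continuous_on (UNIV \<times> W) (\<lambda>(x,w). f x w)"
    and deriv: "\<And>x w. w \<in> W \<Longrightarrow> ((\<lambda>x. f x w) has_derivative (\<lambda>h. inner (f' x w) h)) (at x)"
    and f'_cont: "continuous_on (UNIV \<times> W) (\<lambda>(x,w). f' x w)"
  obtains D where "((\<lambda>t. (maxF f W (x + t *\<^sub>R h) - maxF f W x) / t) \<longlongrightarrow> D) (at_right 0)"
    "\<And>w. w \<in> W \<Longrightarrow> f x w = maxF f W x \<Longrightarrow> inner (f' x w) h \<le> D"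
proof -
  note cf = continuous_on_section[OF f_cont]
  have cd: "continuous_on W (\<lambda>w. inner (f' x w) h)"
    by (intro continuous_intros continuous_on_section[OF f'_cont])
  let ?F = "maxF f W"
  have upper: "f y w \<le> ?F y" if "w \<in> W" for y w
    by (rule maxF_upper[of W f, OF W(1) cf that])
  define V where "V = {w\<in>W. f x w = ?F x}"
  have "V = W \<inter> f x -` {?F x}" by (auto simp: V_def)
  then have "closed V" 
    using cf[of x] continuous_on_closed_vimage[OF compact_imp_closed[OF W(1)], of "f x"]
    by (metis Int_commute closed_singleton)
  then have "compact V"
    using compact_Int_closed[OF W(1)] by (metis Int_absorb1 V_def Collect_subset mem_Collect_eq subsetI)
  moreover have "V \<noteq> {}" using maxF_attained[of W f x, OF W cf] by (force simp: V_def)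
  moreover have "continuous_on V (\<lambda>w. inner (f' x w) h)"
    by (rule continuous_on_subset[OF cd]) (auto simp: V_def)
  ultimately obtain w0 where w0: "w0 \<in> V" and max: "\<forall>w\<in>V. inner (f' x w) h \<le> inner (f' x w0) h"
    using continuous_attains_sup by blast
  define D where "D = inner (f' x w0) h"
  have "((\<lambda>t. (?F (x + t *\<^sub>R h) - ?F x) / t) \<longlongrightarrow> D) (at_right 0)"
  proof (rule tendstoI)
    fix e :: real assume e: "e > 0"
    \<comment> \<open>With this tolerance the expansion error along \<open>t *\<^sub>R h\<close> is
      at most \<open>t * (e/3)\<close>; the summand 1 covers \<open>h = 0\<close>.\<close>
    define e' where "e' = e / (3 * (norm h + 1))"
    have e': "e' > 0" using e by (simp add: e'_def add_nonneg_pos)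
    have e'h: "e' * norm h \<le> e/3"
      using e by (simp add: e'_def divide_simps add_nonneg_pos)
    obtain d where d: "d > 0"
      and db: "\<And>k w. w \<in> W \<Longrightarrow> norm k < d \<Longrightarrow> \<bar>f (x + k) w - f x w - inner (f' x w) k\<bar> \<le> e' * norm k"
      using uniform_derivative_bound[OF W(1) deriv f'_cont e'] by blast
    \<comment> \<open>These are the points whose slope exceeds \<open>D\<close> by at least
      \<open>e/3\<close>. None of them is a maximiser at \<open>x\<close>, so by compactness their
      values stay below \<open>?F x\<close> by a fixed gap, which a short step cannot make
      up.\<close>
    define U where "U = {w\<in>W. inner (f' x w) h \<ge> D + e/3}"
    have "U = W \<inter> (\<lambda>w. inner (f' x w) h) -` {D + e/3..}" by (auto simp: U_def)
    then have "closed U" 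
      using cd continuous_on_closed_vimage[OF compact_imp_closed[OF W(1)], of "\<lambda>w. inner (f' x w) h"]
      by (metis Int_commute closed_atLeast)
    then have cU: "compact U"
      using compact_Int_closed[OF W(1)] by (metis Int_absorb1 U_def Collect_subset mem_Collect_eq subsetI)
    have lt: "f x w < ?F x" if "w \<in> U" for w
    proof -
      have "w \<notin> V" using that e max by (force simp: U_def D_def)
      then show ?thesis using that upper[of w x] by (force simp: U_def V_def)
    qed
    obtain \<gamma> where \<gamma>: "\<gamma> > 0" "\<And>w. w \<in> U \<Longrightarrow> f x w \<le> ?F x - \<gamma>"
    proof (cases "U = {}")
      case True then show ?thesis using that[of 1] by auto
    next
      case False
      have "continuous_on U (f x)" by (rule continuous_on_subset[OF cf]) (auto simp: U_def)
      then obtain u where "u \<in> U" "\<forall>w\<in>U. f x w \<le> f x u"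
        using continuous_attains_sup[OF cU False] by blast
      then show ?thesis using that[of "?F x - f x u"] lt by force
    qed
    obtain M where M: "\<And>w. w \<in> W \<Longrightarrow> inner (f' x w) h \<le> M" 
      using continuous_attains_sup[OF W cd] by blast
    \<comment> \<open>As soon as \<open>t * c\<close> is below the gap \<gamma>, a point of
      \<open>U\<close> cannot bring \<open>?F\<close> above the upper estimate, however steep its
      slope (at most \<open>M\<close>) and however negative \<open>D\<close>.\<close>
    define c where "c = \<bar>M\<bar> + e + \<bar>D\<bar>"
    have c: "c > 0" using e by (simp add: c_def)
    have "\<forall>\<^sub>F t in at_right 0. t > 0 \<and> t < d / (norm h + 1) \<and> t < \<gamma> / c"
      unfolding eventually_at_right_field
      by (rule exI[of _ "min (d / (norm h + 1)) (\<gamma> / c)"])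
        (use d \<gamma> c in \<open>auto simp: add_nonneg_pos\<close>)
    then show "\<forall>\<^sub>F t in at_right 0. dist ((?F (x + t *\<^sub>R h) - ?F x) / t) D < e"
    proof eventually_elim
      case (elim t)
      then have t: "t > 0" "t * (norm h + 1) < d" "t * c < \<gamma>"
        using c by (auto simp: pos_less_divide_eq add_nonneg_pos)
      have small: "norm (t *\<^sub>R h) < d" using t by (simp add: algebra_simps)
      have "t * (e' * norm h) \<le> t * (e / 3)" using e'h t by (intro mult_left_mono) auto
      then have appr: "\<bar>f (x + t *\<^sub>R h) w - f x w - t * inner (f' x w) h\<bar> \<le> t * (e/3)" if "w \<in> W" for w
      proof -
        have "e' * norm (t *\<^sub>R h) = t * (e' * norm h)" using t by simp
        with db[OF that small] \<open>t * (e' * norm h) \<le> t * (e / 3)\<close> show ?thesis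
          unfolding inner_scaleR_right by linarith
      qed
      have w0V: "w0 \<in> W" "f x w0 = ?F x" using w0 by (auto simp: V_def)
      have "?F (x + t *\<^sub>R h) \<ge> f (x + t *\<^sub>R h) w0" using upper w0 by (auto simp: V_def)
      then have lower: "?F (x + t *\<^sub>R h) - ?F x \<ge> t * (D - e/3)"
        using appr[of w0] w0V unfolding D_def right_diff_distrib by linarith
      obtain w where w: "w \<in> W" "f (x + t *\<^sub>R h) w = ?F (x + t *\<^sub>R h)"
        using maxF_attained[of W f "x + t *\<^sub>R h", OF W cf] by blast
      have "?F (x + t *\<^sub>R h) - ?F x \<le> t * (D + 2*e/3)"
      proof (cases "w \<in> U")
        case True
        have "t * inner (f' x w) h \<le> t * \<bar>M\<bar>" using M[OF w(1)] t by (intro mult_left_mono) auto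
        moreover have "t * D \<ge> - (t * \<bar>D\<bar>)" using mult_left_mono[of "-\<bar>D\<bar>" D t] t by simp
        moreover have "t * e > 0" using t e by simp
        moreover have "t * \<bar>M\<bar> + t * e + t * \<bar>D\<bar> < \<gamma>" using t(3) by (simp add: c_def distrib_left)
        ultimately have "?F (x + t *\<^sub>R h) - ?F x \<le> t * D + 2 * (t * (e/3))"
          using \<gamma>(2)[OF True] appr[OF w(1)] w(2) by linarith
        then show ?thesis by (simp add: algebra_simps)
      next
        case False
        then have "t * inner (f' x w) h \<le> t * (D + e/3)" using w t by (intro mult_left_mono) (auto simp: U_def)
        then have "?F (x + t *\<^sub>R h) - ?F x \<le> t * D + 2 * (t * (e/3))"
          using appr[OF w(1)] w(2) upper[OF w(1), of x] unfolding distrib_left by linarith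
        then show ?thesis by (simp add: algebra_simps)
      qed
      then have "(?F (x + t *\<^sub>R h) - ?F x) / t \<le> D + 2*e/3" "(?F (x + t *\<^sub>R h) - ?F x) / t \<ge> D - e/3"
        using lower t by (simp_all add: field_simps)
      then show ?case using e by (auto simp: dist_real_def abs_less_iff)
    qed
  qed
  moreover have "inner (f' x w) h \<le> D" if "w \<in> W" "f x w = ?F x" for w
    using max that by (auto simp: V_def D_def)
  ultimately show ?thesis using that by blast
qed

text \<open>To first order the value along \<open>h\<close> is a convex combination, with weights
  \<open>1 - t\<close> and \<open>t\<close>, of a number at most \<open>c\<close> and one at most
  \<open>c - \<gamma>\<close>, where \<gamma> > 0 exists by compactness. This gains
  \<open>t * \<gamma>\<close>, of which the remainder and the perturbation \<open>y\<close> each use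
  at most a quarter. The room for \<open>y\<close> is reserved for the correction that restores the
  equality constraint.\<close>

lemma uniform_descent:
  fixes f :: "'a::euclidean_space \<Rightarrow> 'w::topological_space \<Rightarrow> real" and f' :: "'a \<Rightarrow> 'w \<Rightarrow> 'a"
  assumes W: "compact W"
    and f_cont: "continuous_on (UNIV \<times> W) (\<lambda>(x,w). f x w)"
    and deriv: "\<And>x w. w \<in> W \<Longrightarrow> ((\<lambda>x. f x w) has_derivative (\<lambda>h. inner (f' x w) h)) (at x)"
    and f'_cont: "continuous_on (UNIV \<times> W) (\<lambda>(x,w). f' x w)"
    and le: "\<And>w. w \<in> W \<Longrightarrow> f x w \<le> c"
    and lt: "\<And>w. w \<in> W \<Longrightarrow> f x w + inner (f' x w) h < c"
  obtains \<eta> \<delta> where "\<eta> > 0" "\<delta> > 0"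
    "\<And>t y w. 0 < t \<Longrightarrow> t < \<delta> \<Longrightarrow> norm y \<le> \<eta> * t \<Longrightarrow> w \<in> W \<Longrightarrow> f (x + t *\<^sub>R h + y) w < c"
proof (cases "W = {}")
  case True then show ?thesis using that[of 1 1] by auto
next
  case False
  have "continuous_on W (\<lambda>w. f x w + inner (f' x w) h)"
    by (intro continuous_intros continuous_on_section[OF f_cont] continuous_on_section[OF f'_cont])
  then obtain u where u: "u \<in> W" "\<forall>w\<in>W. f x w + inner (f' x w) h \<le> f x u + inner (f' x u) h"
    using continuous_attains_sup[OF W False] by blast
  define \<gamma> where "\<gamma> = c - (f x u + inner (f' x u) h)"
  have \<gamma>: "\<gamma> > 0" "\<And>w. w \<in> W \<Longrightarrow> f x w + inner (f' x w) h \<le> c - \<gamma>"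
    using u lt by (auto simp: \<gamma>_def)
  have "continuous_on W (\<lambda>w. norm (f' x w))"
    by (intro continuous_intros continuous_on_section[OF f'_cont])
  then obtain M where M: "\<And>w. w \<in> W \<Longrightarrow> norm (f' x w) \<le> M"
    using continuous_attains_sup[OF W False] by blast
  have M0: "M \<ge> 0" using M False norm_ge_zero order_trans by blast
  define \<eta> where "\<eta> = \<gamma> / (4 * (M + 1))"
  have \<eta>: "\<eta> > 0" "M * \<eta> \<le> \<gamma> / 4" using \<gamma> M0 by (auto simp: \<eta>_def divide_simps add_nonneg_pos)
  define e where "e = \<gamma> / (4 * (norm h + \<eta> + 1))"
  have pos: "norm h + \<eta> + 1 > 0" using \<eta> by (simp add: add_nonneg_pos)
  then have e: "e > 0" "e * (norm h + \<eta>) \<le> \<gamma> / 4"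
    using \<gamma> \<eta> by (auto simp: e_def divide_simps)
  obtain d where d: "d > 0"
    and db: "\<And>k w. w \<in> W \<Longrightarrow> norm k < d \<Longrightarrow> \<bar>f (x + k) w - f x w - inner (f' x w) k\<bar> \<le> e * norm k"
    using uniform_derivative_bound[OF W deriv f'_cont e(1)] by blast
  \<comment> \<open>The bound 1 keeps the weight \<open>1 - t\<close> nonnegative; the quotient
    keeps the whole displacement inside the radius \<open>d\<close>.\<close>
  define \<delta> where "\<delta> = min 1 (d / (norm h + \<eta> + 1))"
  have \<delta>: "\<delta> > 0" using d pos by (simp add: \<delta>_def)
  have "f (x + t *\<^sub>R h + y) w < c" if t: "0 < t" "t < \<delta>" and y: "norm y \<le> \<eta> * t" and w: "w \<in> W" for t y w
  proof -
    let ?k = "t *\<^sub>R h + y"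
    have nk: "norm ?k \<le> t * (norm h + \<eta>)"
      using norm_triangle_ineq[of "t *\<^sub>R h" y] y t by (simp add: algebra_simps)
    also have "\<dots> < d" using t pos by (simp add: \<delta>_def pos_less_divide_eq algebra_simps)
    finally have "\<bar>f (x + ?k) w - f x w - inner (f' x w) ?k\<bar> \<le> e * norm ?k" by (rule db[OF w])
    also have "\<dots> \<le> e * (t * (norm h + \<eta>))" using nk e by (intro mult_left_mono) auto
    also have "\<dots> \<le> t * (\<gamma> / 4)" using mult_left_mono[OF e(2), of t] t by (simp add: algebra_simps)
    finally have 1: "f (x + ?k) w \<le> f x w + inner (f' x w) ?k + t * (\<gamma> / 4)" by linarith
    have "inner (f' x w) y \<le> norm (f' x w) * norm y" by (rule norm_cauchy_schwarz)
    also have "\<dots> \<le> M * (\<eta> * t)" using M[OF w] y M0 by (intro mult_mono) auto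
    also have "\<dots> \<le> t * (\<gamma> / 4)" using mult_left_mono[OF \<eta>(2), of t] t by (simp add: algebra_simps)
    finally have 2: "inner (f' x w) y \<le> t * (\<gamma> / 4)" .
    have "(1 - t) * f x w \<le> (1 - t) * c"
      using t le[OF w] by (intro mult_left_mono) (auto simp: \<delta>_def)
    moreover have "t * (f x w + inner (f' x w) h) \<le> t * (c - \<gamma>)"
      using \<gamma>(2)[OF w] t by (intro mult_left_mono) auto
    moreover have "t * \<gamma> > 0" using t \<gamma> by simp
    ultimately show ?thesis using 1 2 by (simp add: algebra_simps)
  qed
  with \<eta>(1) \<delta> that show ?thesis by blast
qed

subsection \<open>Restoring the equality constraint\<close>

text \<open>The missing mass \<open>1 - sum w I\<close> is placed at the point 0 of
  \<open>S\<close>.\<close>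

lemma convex_subunit_combination:
  assumes "convex S" "0 \<in> S" "finite I"
    and w: "\<And>i. i \<in> I \<Longrightarrow> 0 \<le> w i" "sum w I \<le> (1::real)" and s: "\<And>i. i \<in> I \<Longrightarrow> s i \<in> S"
  shows "(\<Sum>i\<in>I. w i *\<^sub>R s i) \<in> S"
proof (cases "sum w I = 0")
  case True
  then have "\<forall>i\<in>I. w i = 0" using w(1) \<open>finite I\<close> by (simp add: sum_nonneg_eq_0_iff)
  then show ?thesis using assms(2) by simp
next
  case False
  then have pos: "sum w I > 0" using w(1) by (simp add: less_le sum_nonneg)
  have "(\<Sum>i\<in>I. (w i / sum w I) *\<^sub>R s i) \<in> S"
    by (rule convex_sum[OF \<open>finite I\<close> \<open>convex S\<close>]) (use pos w s in \<open>auto simp flip: sum_divide_distrib\<close>)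
  then have "sum w I *\<^sub>R (\<Sum>i\<in>I. (w i / sum w I) *\<^sub>R s i) + (1 - sum w I) *\<^sub>R 0 \<in> S"
    using assms(1,2) w pos by (intro convexD) auto
  then show ?thesis using False by (simp add: scaleR_right.sum)
qed

text \<open>Let \<phi> be a right inverse of \<open>B\<close>. Since \<open>B h = 0\<close> and
  \<open>b x = 0\<close>, the map y - b (x + t h + \<phi> y) is minus the remainder of the
  linearisation of \<open>b\<close> at \<open>x\<close>, which is o(t) when \<open>y\<close> is
  O(t). It therefore maps a ball of radius proportional to \<open>t\<close> into itself, and a fixed
  point of it is a zero of \<open>b\<close>.\<close>

lemma equality_restoration:
  fixes b :: "'a::euclidean_space \<Rightarrow> 'b::euclidean_space"
  assumes A: "convex A" "x \<in> A"
    and b_cont: "continuous_on UNIV b" and b_deriv: "(b has_derivative B) (at x)" and b0: "b x = 0"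
    and r: "r > 0" and surj: "\<And>z. norm z < r \<Longrightarrow> \<exists>k. x + k \<in> A \<and> B k = z"
    and h: "x + h \<in> A" "B h = 0" and \<eta>: "\<eta> > 0"
  obtains \<delta> where "\<delta> > 0"
    "\<And>t. 0 < t \<Longrightarrow> t < \<delta> \<Longrightarrow> \<exists>y. norm y \<le> \<eta> * t \<and> x + t *\<^sub>R h + y \<in> A \<and> b (x + t *\<^sub>R h + y) = 0"
proof -
  interpret B: bounded_linear B using b_deriv has_derivative_bounded_linear by blast
  define S where "S = {k. x + k \<in> A}"
  have S: "convex S" "0 \<in> S" "h \<in> S"
  proof -
    have "S = (\<lambda>a. a - x) ` A" unfolding S_def by (force simp: image_iff)
    then show "convex S" using A convex_translation_subtract by metis
  qed (use A h in \<open>auto simp: S_def\<close>)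
  obtain k where k: "\<And>z. norm z < r \<Longrightarrow> k z \<in> S \<and> B (k z) = z"
    using surj unfolding S_def by (metis mem_Collect_eq)
  \<comment> \<open>Halving puts the vectors of length \<rho> along the axes strictly inside the
    radius \<open>r\<close>, where \<open>k\<close> inverts \<open>B\<close>.\<close>
  define \<rho> where "\<rho> = r / 2"
  have \<rho>: "0 < \<rho>" "\<rho> < r" using r by (auto simp: \<rho>_def)
  have kb: "k (\<rho> *\<^sub>R e) \<in> S" "k (- (\<rho> *\<^sub>R e)) \<in> S"
    "B (k (\<rho> *\<^sub>R e)) = \<rho> *\<^sub>R e" "B (k (- (\<rho> *\<^sub>R e))) = - (\<rho> *\<^sub>R e)" if "e \<in> Basis" for e
    using k[of "\<rho> *\<^sub>R e"] k[of "- (\<rho> *\<^sub>R e)"] \<rho> that by auto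
  \<comment> \<open>a continuous, positively homogeneous right inverse of \<open>B\<close> with values in the cone of \<open>A - x\<close>\<close>
  define \<phi> where "\<phi> y = (\<Sum>e\<in>Basis. (max (y \<bullet> e) 0 / \<rho>) *\<^sub>R k (\<rho> *\<^sub>R e)
      + (max (- (y \<bullet> e)) 0 / \<rho>) *\<^sub>R k (- (\<rho> *\<^sub>R e)))" for y
  have \<phi>_cont: "continuous_on UNIV \<phi>"
    unfolding \<phi>_def using \<rho> by (intro continuous_intros) auto
  have B\<phi>: "B (\<phi> y) = y" for y
  proof -
    have "B (\<phi> y) = (\<Sum>e\<in>Basis. (max (y \<bullet> e) 0 / \<rho>) *\<^sub>R (\<rho> *\<^sub>R e)
      + (max (- (y \<bullet> e)) 0 / \<rho>) *\<^sub>R (- (\<rho> *\<^sub>R e)))"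
      unfolding \<phi>_def B.sum B.add B.scaleR by (intro sum.cong) (auto simp: kb)
    also have "\<dots> = (\<Sum>e\<in>Basis. (y \<bullet> e) *\<^sub>R e)"
      using \<rho> by (intro sum.cong) (auto simp: max_def)
    also have "\<dots> = y" by (rule euclidean_representation)
    finally show ?thesis .
  qed
  define K where "K = (\<Sum>e\<in>Basis. (norm (k (\<rho> *\<^sub>R e)) + norm (k (- (\<rho> *\<^sub>R e)))) / \<rho>)"
  have K0: "K \<ge> 0" unfolding K_def using \<rho> by (intro sum_nonneg) auto
  have \<phi>_bd: "norm (\<phi> y) \<le> K * norm y" for y
    unfolding \<phi>_def K_def sum_distrib_right
  proof (rule sum_norm_le)
    fix e :: 'b assume e: "e \<in> Basis"
    have m: "max (y \<bullet> e) 0 / \<rho> \<le> norm y / \<rho>" "max (- (y \<bullet> e)) 0 / \<rho> \<le> norm y / \<rho>"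
      using Basis_le_norm[OF e, of y] \<rho> by (auto intro!: divide_right_mono)
    have "norm ((max (y \<bullet> e) 0 / \<rho>) *\<^sub>R k (\<rho> *\<^sub>R e) + (max (- (y \<bullet> e)) 0 / \<rho>) *\<^sub>R k (- (\<rho> *\<^sub>R e)))
      \<le> (max (y \<bullet> e) 0 / \<rho>) * norm (k (\<rho> *\<^sub>R e)) + (max (- (y \<bullet> e)) 0 / \<rho>) * norm (k (- (\<rho> *\<^sub>R e)))"
      using \<rho> by (intro norm_triangle_le) simp
    also have "\<dots> \<le> (norm y / \<rho>) * norm (k (\<rho> *\<^sub>R e)) + (norm y / \<rho>) * norm (k (- (\<rho> *\<^sub>R e)))"
      using m by (intro add_mono mult_right_mono) auto
    finally show "norm ((max (y \<bullet> e) 0 / \<rho>) *\<^sub>R k (\<rho> *\<^sub>R e) + (max (- (y \<bullet> e)) 0 / \<rho>) *\<^sub>R k (- (\<rho> *\<^sub>R e)))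
      \<le> (norm (k (\<rho> *\<^sub>R e)) + norm (k (- (\<rho> *\<^sub>R e)))) / \<rho> * norm y"
      by (simp add: algebra_simps add_divide_distrib)
  qed
  \<comment> \<open>The point is the combination of \<open>h\<close> with weight \<open>t\<close>
    and of a point of \<open>S\<close> with weight \<open>1 - t\<close>. The latter is a subunit
    combination of the vectors \<open>s e\<close>, selected by the sign of the coordinate:
    \<open>t \<le> 1/2\<close> and the bound on \<open>y\<close> keep its total weight at most
    1.\<close>
  have \<phi>_mem: "t *\<^sub>R h + \<phi> y \<in> S" if t: "0 < t" "t \<le> 1/2" and y: "DIM('b) * norm y \<le> \<rho> / 2" for t y
  proof -
    define s where "s e = k (if y \<bullet> e \<ge> 0 then \<rho> *\<^sub>R e else - (\<rho> *\<^sub>R e))" for e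
    have "(\<Sum>e\<in>Basis. \<bar>y \<bullet> e\<bar>) \<le> (\<Sum>e\<in>(Basis :: 'b set). norm y)"
      by (intro sum_mono) (simp add: Basis_le_norm)
    then have sm: "(\<Sum>e\<in>Basis. \<bar>y \<bullet> e\<bar>) \<le> \<rho> / 2" using y by simp
    have "(\<Sum>e\<in>Basis. (\<bar>y \<bullet> e\<bar> / \<rho> / (1 - t)) *\<^sub>R s e) \<in> S"
    proof (rule convex_subunit_combination[OF S(1,2)])
      have "(\<Sum>e\<in>Basis. \<bar>y \<bullet> e\<bar> / \<rho> / (1 - t)) = (\<Sum>e\<in>Basis. \<bar>y \<bullet> e\<bar>) / (\<rho> * (1 - t))"
        by (simp add: sum_divide_distrib)
      also have "\<dots> \<le> 1"
      proof -
        have "\<rho> / 2 \<le> \<rho> * (1 - t)" using t mult_left_mono[of "1/2" "1 - t" \<rho>] \<rho> by simp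
        with sm have "(\<Sum>e\<in>Basis. \<bar>y \<bullet> e\<bar>) \<le> \<rho> * (1 - t)" by (rule order_trans)
        then show ?thesis using t \<rho> by (subst divide_le_eq_1_pos) auto
      qed
      finally show "(\<Sum>e\<in>Basis. \<bar>y \<bullet> e\<bar> / \<rho> / (1 - t)) \<le> 1" .
    qed (use t \<rho> kb in \<open>auto simp: s_def\<close>)
    then have "t *\<^sub>R h + (1 - t) *\<^sub>R (\<Sum>e\<in>Basis. (\<bar>y \<bullet> e\<bar> / \<rho> / (1 - t)) *\<^sub>R s e) \<in> S"
      using t S by (intro convexD) auto
    moreover have "(1 - t) *\<^sub>R (\<Sum>e\<in>Basis. (\<bar>y \<bullet> e\<bar> / \<rho> / (1 - t)) *\<^sub>R s e) = \<phi> y"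
      unfolding \<phi>_def scaleR_right.sum
      by (intro sum.cong) (use t in \<open>auto simp: s_def max_def\<close>)
    ultimately show ?thesis by simp
  qed
  \<comment> \<open>On the ball of radius \<open>\<sigma> * t\<close> this keeps the correction
    within \<open>\<eta> * t\<close>. Below, \<open>t * c\<close> bounds the full displacement, so
    the tolerance \<open>\<sigma> / c\<close> in the derivative of \<open>b\<close> returns exactly
    the radius \<open>\<sigma> * t\<close>.\<close>
  define \<sigma> where "\<sigma> = \<eta> / (K + 1)"
  have \<sigma>: "\<sigma> > 0" "K * \<sigma> \<le> \<eta>" using \<eta> K0 by (auto simp: \<sigma>_def divide_simps add_nonneg_pos)
  define c where "c = norm h + K * \<sigma> + 1"
  have c: "c > 0" using K0 \<sigma> by (simp add: c_def add_nonneg_pos)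
  have "\<sigma> / c > 0" using \<sigma> c by simp
  then obtain d where d: "d > 0"
    and db: "\<And>y. norm (y - x) < d \<Longrightarrow> norm (b y - b x - B (y - x)) \<le> \<sigma> / c * norm (y - x)"
    using b_deriv unfolding has_derivative_at_alt by blast
  \<comment> \<open>The first and third bounds give the premises of \<open>\<phi>_mem\<close>; the
    second keeps the displacement within the radius \<open>d\<close> of the expansion of
    \<open>b\<close>.\<close>
  define \<delta> where "\<delta> = min (1/2) (min (d / c) (\<rho> / (2 * DIM('b) * \<sigma>)))"
  have "\<delta> > 0" using d c \<rho> \<sigma> by (simp add: \<delta>_def)
  moreover have "\<exists>y. norm y \<le> \<eta> * t \<and> x + t *\<^sub>R h + y \<in> A \<and> b (x + t *\<^sub>R h + y) = 0"
    if t: "0 < t" "t < \<delta>" for t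
  proof -
    define \<psi> where "\<psi> y = y - b (x + (t *\<^sub>R h + \<phi> y))" for y
    have bd: "norm (t *\<^sub>R h + \<phi> y) \<le> t * c" "norm (t *\<^sub>R h + \<phi> y) < d" "norm (\<phi> y) \<le> \<eta> * t"
      if y: "norm y \<le> \<sigma> * t" for y
    proof -
      have "norm (\<phi> y) \<le> K * (\<sigma> * t)"
        using \<phi>_bd[of y] mult_left_mono[OF y K0] by linarith
      moreover have "K * \<sigma> * t \<le> \<eta> * t" using \<sigma> t by (intro mult_right_mono) auto
      ultimately show "norm (\<phi> y) \<le> \<eta> * t" by (simp add: mult.assoc)
      show *: "norm (t *\<^sub>R h + \<phi> y) \<le> t * c"
        using norm_triangle_ineq[of "t *\<^sub>R h" "\<phi> y"] \<open>norm (\<phi> y) \<le> K * (\<sigma> * t)\<close> t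
        by (simp add: c_def algebra_simps)
      have "t * c < d" using t c by (simp add: \<delta>_def pos_less_divide_eq)
      with * show "norm (t *\<^sub>R h + \<phi> y) < d" by simp
    qed
    obtain y where y: "y \<in> cball 0 (\<sigma> * t)" "\<psi> y = y"
    proof (rule brouwer_ball[of "\<sigma> * t" 0 \<psi>])
      show "0 < \<sigma> * t" using \<sigma> t by simp
      show "continuous_on (cball 0 (\<sigma> * t)) \<psi>"
        unfolding \<psi>_def
        by (intro continuous_intros continuous_on_compose2[OF b_cont] continuous_on_subset[OF \<phi>_cont]) auto
      show "\<psi> \<in> cball 0 (\<sigma> * t) \<rightarrow> cball 0 (\<sigma> * t)"
      proof
        fix y :: 'b assume "y \<in> cball 0 (\<sigma> * t)"
        then have y: "norm y \<le> \<sigma> * t" by simp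
        let ?u = "t *\<^sub>R h + \<phi> y"
        have "norm (\<psi> y) = norm (b (x + ?u) - b x - B (x + ?u - x))"
          by (simp add: \<psi>_def b0 B.add B.scaleR h B\<phi> norm_minus_commute)
        also have "\<dots> \<le> \<sigma> / c * norm ?u" using db[of "x + ?u"] bd[OF y] by simp
        also have "\<dots> \<le> \<sigma> / c * (t * c)" using bd(1)[OF y] \<sigma> c by (intro mult_left_mono) auto
        also have "\<dots> = \<sigma> * t" using c by simp
        finally show "\<psi> y \<in> cball 0 (\<sigma> * t)" by simp
      qed
    qed auto
    then have ny: "norm y \<le> \<sigma> * t" and by0: "b (x + (t *\<^sub>R h + \<phi> y)) = 0" by (auto simp: \<psi>_def)
    have "DIM('b) * norm y \<le> \<rho> / 2"
    proof -
      have "DIM('b) * norm y \<le> DIM('b) * (\<sigma> * t)" using ny by (intro mult_left_mono) auto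
      also have "\<dots> \<le> \<rho> / 2"
        using t \<sigma> by (simp add: \<delta>_def pos_less_divide_eq field_simps)
      finally show ?thesis .
    qed
    then have "t *\<^sub>R h + \<phi> y \<in> S" using \<phi>_mem t by (auto simp: \<delta>_def)
    then show ?thesis using by0 bd(3)[OF ny] by (auto simp: S_def add.assoc)
  qed
  ultimately show ?thesis using that by blast
qed

subsection \<open>Separation and convex hulls\<close>

text \<open>The pair \<open>(p, c)\<close> encodes the affine function with gradient
  \<open>p\<close> and value \<open>c\<close> at 0, so that the duality argument takes place in a
  finite-dimensional product space.\<close>

definition multiplier_cone :: "'a::euclidean_space set \<Rightarrow> ('a \<Rightarrow> 'b::euclidean_space) \<Rightarrow> ('a \<times> real) set" where
  "multiplier_cone C B = {(p, c). \<exists>\<nu>. \<forall>h\<in>C. 0 \<le> p \<bullet> h + \<nu> \<bullet> B h + c}"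

lemma convex_cone_multiplier_cone: "convex (multiplier_cone C B)" "cone (multiplier_cone C B)"
proof -
  have "u + v \<in> multiplier_cone C B" if uv: "u \<in> multiplier_cone C B" "v \<in> multiplier_cone C B" for u v
  proof -
    obtain \<nu> \<nu>' where \<nu>: "\<forall>h\<in>C. 0 \<le> fst u \<bullet> h + \<nu> \<bullet> B h + snd u" "\<forall>h\<in>C. 0 \<le> fst v \<bullet> h + \<nu>' \<bullet> B h + snd v"
      using uv by (auto simp: multiplier_cone_def)
    have "0 \<le> fst (u + v) \<bullet> h + (\<nu> + \<nu>') \<bullet> B h + snd (u + v)" if "h \<in> C" for h
      using add_nonneg_nonneg[OF \<nu>(1)[rule_format, OF that] \<nu>(2)[rule_format, OF that]]
      by (simp add: inner_add_left)
    then show ?thesis by (auto simp: multiplier_cone_def split_beta)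
  qed
  moreover have "t *\<^sub>R u \<in> multiplier_cone C B" if u: "u \<in> multiplier_cone C B" and t: "t \<ge> 0" for u t
  proof -
    obtain \<nu> where \<nu>: "\<forall>h\<in>C. 0 \<le> fst u \<bullet> h + \<nu> \<bullet> B h + snd u"
      using u by (auto simp: multiplier_cone_def)
    have "0 \<le> fst (t *\<^sub>R u) \<bullet> h + (t *\<^sub>R \<nu>) \<bullet> B h + snd (t *\<^sub>R u)" if "h \<in> C" for h
      using mult_nonneg_nonneg[OF t \<nu>[rule_format, OF that]] by (simp add: distrib_left)
    then show ?thesis unfolding multiplier_cone_def split_beta by blast
  qed
  ultimately show "convex (multiplier_cone C B)" "cone (multiplier_cone C B)"
    using convex_cone[of "multiplier_cone C B"] by blast+
qed

text \<open>Without an equality term the multiplier drops out and the cone is an intersection of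
  closed half-spaces.\<close>

lemma closed_multiplier_cone_zero:
  "closed (multiplier_cone C (\<lambda>_ :: 'a::euclidean_space. 0 :: 'b::euclidean_space))"
proof -
  have "multiplier_cone C (\<lambda>_ :: 'a. 0 :: 'b) = (\<Inter>h\<in>C. {z. 0 \<le> z \<bullet> (h, 1)})"
    by (auto simp: multiplier_cone_def)
  then show ?thesis
    by (simp only:) (intro closed_INT closed_Collect_le continuous_intros ballI)
qed

text \<open>A limit of members is again a member once their multipliers have a convergent
  subsequence. Boundedness of the multipliers comes from the fact that \<open>B\<close> maps
  \<open>C\<close> onto every vector of norm below \<open>r\<close>.\<close>

lemma closed_multiplier_cone:
  fixes B :: "'a::euclidean_space \<Rightarrow> 'b::euclidean_space"
  assumes r: "r > 0" and surj: "\<And>z. norm z < r \<Longrightarrow> \<exists>k\<in>C. B k = z"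
  shows "closed (multiplier_cone C B)"
  unfolding closed_sequential_limits
proof (intro allI impI)
  fix z :: "nat \<Rightarrow> 'a \<times> real" and l
  assume "(\<forall>n. z n \<in> multiplier_cone C B) \<and> z \<longlonglongrightarrow> l"
  then have mem: "\<And>n. z n \<in> multiplier_cone C B" and lim: "z \<longlonglongrightarrow> l" by auto
  have "\<forall>n. \<exists>\<nu>. \<forall>h\<in>C. 0 \<le> fst (z n) \<bullet> h + \<nu> \<bullet> B h + snd (z n)"
    using mem by (auto simp: multiplier_cone_def split_beta)
  then obtain \<nu> where \<nu>: "\<And>n h. h \<in> C \<Longrightarrow> 0 \<le> fst (z n) \<bullet> h + \<nu> n \<bullet> B h + snd (z n)"
    by metis
  obtain Z where Z: "\<And>n. norm (z n) \<le> Z"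
    using convergent_imp_bounded[OF lim] by (auto simp: bounded_iff)
  \<comment> \<open>Evaluating the inequalities at a preimage of \<open>w\<close> in
    \<open>C\<close> bounds the inner products with \<open>w\<close> from below. Using both signs of
    each axis direction then bounds every coordinate of the multipliers on both sides.\<close>
  have lower: "\<exists>m. \<forall>n. m \<le> \<nu> n \<bullet> w" if w: "norm w < r" for w
  proof -
    obtain k where k: "k \<in> C" "B k = w" using surj[OF w] by blast
    have "- (Z * norm (k, 1 :: real)) \<le> \<nu> n \<bullet> w" for n
    proof -
      have "z n \<bullet> (k, 1) \<le> norm (z n) * norm (k, 1 :: real)" by (rule norm_cauchy_schwarz)
      also have "\<dots> \<le> Z * norm (k, 1 :: real)" using Z by (intro mult_right_mono) auto
      finally have "fst (z n) \<bullet> k + snd (z n) \<le> Z * norm (k, 1 :: real)" by (simp add: inner_prod_def)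
      then show ?thesis using \<nu>[OF k(1), of n] k by simp
    qed
    then show ?thesis by blast
  qed
  have "\<exists>m. \<forall>n. \<bar>\<nu> n \<bullet> e\<bar> \<le> m" if e: "e \<in> Basis" for e
  proof -
    obtain m m' where m: "\<forall>n. m \<le> \<nu> n \<bullet> ((r/2) *\<^sub>R e)" "\<forall>n. m' \<le> \<nu> n \<bullet> (- ((r/2) *\<^sub>R e))"
      using lower[of "(r/2) *\<^sub>R e"] lower[of "- ((r/2) *\<^sub>R e)"] e r by auto
    have "\<bar>\<nu> n \<bullet> e\<bar> \<le> (\<bar>m\<bar> + \<bar>m'\<bar>) / (r/2)" for n
    proof -
      have "\<bar>\<nu> n \<bullet> e\<bar> * (r/2) = \<bar>(\<nu> n \<bullet> e) * (r/2)\<bar>" using r by (simp add: abs_mult)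
      also have "\<dots> \<le> \<bar>m\<bar> + \<bar>m'\<bar>"
        using m[THEN spec, of n] by (simp add: algebra_simps)
      finally show ?thesis using r by (simp add: pos_le_divide_eq)
    qed
    then show ?thesis by blast
  qed
  then obtain m where m: "\<And>e n. e \<in> Basis \<Longrightarrow> \<bar>\<nu> n \<bullet> e\<bar> \<le> m e" by metis
  have "norm (\<nu> n) \<le> sum m Basis" for n
    using norm_le_l1[of "\<nu> n"] sum_mono[of Basis "\<lambda>e. \<bar>\<nu> n \<bullet> e\<bar>" m] m by force
  then have "bounded (range \<nu>)" by (auto simp: bounded_iff)
  then obtain \<nu>' s where s: "strict_mono s" and \<nu>': "(\<nu> \<circ> s) \<longlonglongrightarrow> \<nu>'"
    using bounded_imp_convergent_subsequence by blast
  have "0 \<le> fst l \<bullet> h + \<nu>' \<bullet> B h + snd l" if h: "h \<in> C" for h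
  proof (rule LIMSEQ_le_const)
    have "(z \<circ> s) \<longlonglongrightarrow> l" by (rule LIMSEQ_subseq_LIMSEQ[OF lim s])
    then show "(\<lambda>n. fst ((z \<circ> s) n) \<bullet> h + (\<nu> \<circ> s) n \<bullet> B h + snd ((z \<circ> s) n)) \<longlonglongrightarrow> fst l \<bullet> h + \<nu>' \<bullet> B h + snd l"
      using \<nu>' by (intro tendsto_intros)
  qed (use \<nu>[OF h] in auto)
  then show "l \<in> multiplier_cone C B" by (auto simp: multiplier_cone_def split_beta)
qed

text \<open>A functional separating \<open>Q\<close> from the cone, scaled to have last component 1,
  is evaluation of affine functions at a point. Nonnegativity on the cone puts this point into
  \<open>C\<close> and into the kernel of \<open>B\<close>, while negativity on \<open>Q\<close>
  contradicts \<open>incons\<close> there.\<close>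

lemma multiplier_exists:
  fixes B :: "'a::euclidean_space \<Rightarrow> 'b::euclidean_space"
  assumes C: "closed C" "convex C" "0 \<in> C" and B: "linear B"
    and M: "closed (multiplier_cone C B)"
    and Q: "compact Q" "convex Q" "Q \<noteq> {}"
    and incons: "\<And>h. h \<in> C \<Longrightarrow> B h = 0 \<Longrightarrow> \<exists>q\<in>Q. 0 \<le> fst q \<bullet> h + snd q"
  shows "Q \<inter> multiplier_cone C B \<noteq> {}"
proof
  assume disj: "Q \<inter> multiplier_cone C B = {}"
  let ?M = "multiplier_cone C B"
  interpret B: linear B by (rule B)
  note Mcone = convex_cone_multiplier_cone[of C B]
  have M0: "0 \<in> ?M" by (auto simp: multiplier_cone_def zero_prod_def intro: exI[of _ 0])
  obtain a \<beta> where lt: "\<And>q. q \<in> Q \<Longrightarrow> a \<bullet> q < \<beta>" and gt: "\<And>q. q \<in> ?M \<Longrightarrow> a \<bullet> q > \<beta>"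
    using separating_hyperplane_compact_closed[OF Q(2,1,3) Mcone(1) M disj] by blast
  have \<beta>: "\<beta> < 0" using gt[OF M0] by simp
  \<comment> \<open>A member with a negative value could be rescaled within the cone to have the
    value \<beta>, which the separation excludes.\<close>
  have nonneg: "a \<bullet> q \<ge> 0" if q: "q \<in> ?M" for q
  proof (rule ccontr)
    assume neg: "\<not> a \<bullet> q \<ge> 0"
    then have "(\<beta> / (a \<bullet> q)) *\<^sub>R q \<in> ?M" using Mcone(2) q \<beta> by (auto simp: cone_def divide_nonpos_nonpos)
    from gt[OF this] neg show False by simp
  qed
  obtain h \<tau> where a: "a = (h, \<tau>)" by fastforce
  have "(0, 1) \<in> ?M" by (auto simp: multiplier_cone_def intro: exI[of _ 0])
  from nonneg[OF this] have \<tau>: "\<tau> \<ge> 0" by (simp add: a)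
  \<comment> \<open>The pairs \<open>(adjoint B \<nu>, 0)\<close> lie in the cone for every \<nu>,
    being cancelled by the multiplier \<open>- \<nu>\<close>; the choice \<nu> =
    \<open>- B h\<close> is decisive.\<close>
  have Bh: "B h = 0"
  proof -
    have "0 \<le> \<nu> \<bullet> B h" for \<nu>
    proof -
      have "(adjoint B \<nu>, 0) \<in> ?M"
        by (auto simp: multiplier_cone_def inner_commute[of "adjoint B \<nu>"] adjoint_works[OF B]
            inner_commute[of \<nu>] intro!: exI[of _ "- \<nu>"])
      from nonneg[OF this] show ?thesis by (simp add: a adjoint_works[OF B] inner_commute)
    qed
    from this[of "- B h"] have "B h \<bullet> B h = 0" using inner_ge_zero[of "B h"] by simp
    then show ?thesis by (simp only: inner_eq_zero_iff)
  qed
  \<comment> \<open>The functional may be horizontal (\<open>\<tau> = 0\<close>); tilting it slightly keeps both inequalities, because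
    \<open>0 \<in> C\<close> makes the last component nonnegative on the cone.\<close>
  obtain \<tau>' where \<tau>': "\<tau>' > 0" "\<And>q. q \<in> Q \<Longrightarrow> (h, \<tau>') \<bullet> q < 0" "\<And>q. q \<in> ?M \<Longrightarrow> 0 \<le> (h, \<tau>') \<bullet> q"
  proof -
    obtain R where R: "R > 0" "\<And>q. q \<in> Q \<Longrightarrow> norm q \<le> R"
      using compact_imp_bounded[OF Q(1)] unfolding bounded_pos by blast
    \<comment> \<open>This tilt adds at most half of the separation gap \<open>- \<beta>\<close> on
      \<open>Q\<close>.\<close>
    let ?t = "- \<beta> / (2 * R)"
    have t: "?t > 0" using \<beta> R by (simp add: divide_neg_pos)
    show ?thesis
    proof (rule that[of "\<tau> + ?t"])
      show "\<tau> + ?t > 0" using \<tau> t by linarith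
      show "(h, \<tau> + ?t) \<bullet> q < 0" if "q \<in> Q" for q
      proof -
        have "\<bar>snd q\<bar> \<le> R" using R(2)[OF that] norm_snd_le[of "snd q" "fst q"] by simp
        then have "?t * snd q \<le> ?t * R" using t by (intro mult_left_mono) auto
        also have "\<dots> = - \<beta> / 2" using R by simp
        finally show ?thesis using lt[OF that] \<beta> by (simp add: a inner_prod_def algebra_simps)
      qed
      show "0 \<le> (h, \<tau> + ?t) \<bullet> q" if q: "q \<in> ?M" for q
      proof -
        have "snd q \<ge> 0" using q C(3) by (force simp: multiplier_cone_def B.zero)
        then have "?t * snd q \<ge> 0" using t by (intro mult_nonneg_nonneg) auto
        then show ?thesis using nonneg[OF q] by (simp add: a inner_prod_def algebra_simps)
      qed
    qed
  qed
  let ?h = "(1 / \<tau>') *\<^sub>R h"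
  \<comment> \<open>Bipolar argument: a half-space that contains \<open>C\<close> but not the point
    is itself a member of the cone, with multiplier 0, and would get a negative value.\<close>
  have "?h \<in> C"
  proof (rule ccontr)
    assume "?h \<notin> C"
    then obtain p \<gamma> where p: "p \<bullet> ?h < \<gamma>" "\<forall>x\<in>C. p \<bullet> x > \<gamma>"
      using separating_hyperplane_closed_point[OF C(2,1)] by blast
    then have "(p, - \<gamma>) \<in> ?M" by (fastforce simp: multiplier_cone_def intro: exI[of _ 0])
    from \<tau>'(3)[OF this] have "\<tau>' * \<gamma> \<le> p \<bullet> h" by (simp add: inner_commute)
    then show False using p(1) \<tau>'(1) by (simp add: field_simps)
  qed
  moreover have "B ?h = 0" using Bh by (simp add: B.scaleR)
  ultimately obtain q where q: "q \<in> Q" "0 \<le> fst q \<bullet> ?h + snd q" using incons by blast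
  have "0 \<le> \<tau>' * (fst q \<bullet> ?h + snd q)" using q \<tau>'(1) by (intro mult_nonneg_nonneg) auto
  also have "\<dots> = (h, \<tau>') \<bullet> q" using \<tau>'(1) by (simp add: inner_prod_def algebra_simps inner_commute)
  finally show False using \<tau>'(2)[OF q(1)] by simp
qed

section \<open>Decomposition of points of convex hulls\<close>

lemma convex_hull_UN_split:
  fixes P :: "'i \<Rightarrow> 'a::euclidean_space set"
  assumes "finite I" and x: "x \<in> convex hull (\<Union>i\<in>I. P i)"
  obtains \<theta> s where "\<And>i. i \<in> I \<Longrightarrow> 0 \<le> \<theta> i" "sum \<theta> I = 1"
    "\<And>i. i \<in> I \<Longrightarrow> \<theta> i > 0 \<Longrightarrow> s i \<in> convex hull P i" "x = (\<Sum>i\<in>I. \<theta> i *\<^sub>R s i)"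
proof -
  \<comment> \<open>Empty sets supply no point: their indices are removed and get weight 0. This is
    why \<open>s i\<close> is claimed to lie in a hull only where the weight is positive.\<close>
  let ?J = "{i\<in>I. P i \<noteq> {}}"
  have fin: "finite ?J" using assms by simp
  have "(\<Union>i\<in>I. P i) \<subseteq> \<Union>((\<lambda>i. convex hull P i) ` ?J)"
    using hull_subset by fastforce
  then have "x \<in> convex hull (\<Union>((\<lambda>i. convex hull P i) ` ?J))"
    using x hull_mono by blast
  then obtain c s where c: "\<forall>i\<in>?J. 0 \<le> c i" "sum c ?J = 1" "\<forall>i\<in>?J. s i \<in> convex hull P i"
    "x = (\<Sum>i\<in>?J. c i *\<^sub>R s i)"
    using convex_hull_finite_union[OF fin, of "\<lambda>i. convex hull P i"] by auto
  let ?c = "\<lambda>i. if i \<in> ?J then c i else 0"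
  have "sum ?c I = 1" "x = (\<Sum>i\<in>I. ?c i *\<^sub>R s i)"
    using c(2,4) \<open>finite I\<close> by (auto simp: sum.inter_filter if_distrib intro!: sum.mono_neutral_cong_left cong: if_cong)
  then show ?thesis using c by (intro that[of ?c s]) (auto split: if_splits)
qed

text \<open>The level 0 of the second component supports \<open>P\<close> from above. An average of
  nonpositive numbers vanishes only if every term with positive weight does, so only points on that
  level contribute; \<open>?S\<close> expresses this as a convex set containing
  \<open>P\<close>.\<close>

lemma convex_hull_supporting_level:
  fixes P :: "('a::real_vector \<times> real) set"
  assumes x: "(x, 0) \<in> convex hull P" and le: "\<And>q. q \<in> P \<Longrightarrow> snd q \<le> 0"
  shows "x \<in> convex hull {u. (u, 0) \<in> P}"
proof -
  let ?H = "convex hull {u. (u, 0) \<in> P}"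
  let ?S = "{q :: 'a \<times> real. snd q \<le> 0 \<and> (snd q = 0 \<longrightarrow> fst q \<in> ?H)}"
  have "convex ?S"
  proof (rule convexI)
    fix q r and u v :: real assume q: "q \<in> ?S" and r: "r \<in> ?S" and uv: "0 \<le> u" "0 \<le> v" "u + v = 1"
    have 1: "u * snd q \<le> 0" "v * snd r \<le> 0" using q r uv by (auto simp: mult_nonneg_nonpos)
    have "u *\<^sub>R fst q + v *\<^sub>R fst r \<in> ?H" if "u * snd q + v * snd r = 0"
    proof -
      have z: "u * snd q = 0" "v * snd r = 0" using 1 that by linarith+
      consider "u = 0" | "v = 0" | "snd q = 0" "snd r = 0" using z by auto
      then show ?thesis
      proof cases
        case 3 then show ?thesis using q r uv by (auto intro!: convexD convex_convex_hull)
      qed (use z q r uv in auto)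
    qed
    then show "u *\<^sub>R q + v *\<^sub>R r \<in> ?S" using 1 by auto
  qed
  moreover have "P \<subseteq> ?S" using le by (auto intro!: hull_inc)
  ultimately have "convex hull P \<subseteq> ?S" by (simp add: hull_minimal)
  then show ?thesis using x by auto
qed

text \<open>The hull points are pulled back to \<open>X\<close> and numbered from 1, as in (D). Here
  \<open>m\<close> is at least 1 because a set whose hull contains \<open>x\<close> is
  nonempty.\<close>

lemma caratheodory_indexed:
  fixes G :: "'t \<Rightarrow> 'a::euclidean_space"
  assumes "x \<in> convex hull (G ` X)"
  obtains m p c where "m \<in> {1..DIM('a) + 1}" "\<And>j. j \<in> {1..m} \<Longrightarrow> p j \<in> X \<and> 0 \<le> c j"
    "x = (\<Sum>j=1..m. c j *\<^sub>R G (p j))"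
proof -
  obtain S where S: "finite S" "S \<subseteq> G ` X" "card S \<le> DIM('a) + 1" "x \<in> convex hull S"
    using assms unfolding caratheodory[of "G ` X"] by blast
  then obtain u where u: "\<forall>y\<in>S. 0 \<le> u y" "(\<Sum>y\<in>S. u y *\<^sub>R y) = x"
    by (auto simp: convex_hull_finite)
  have "S \<noteq> {}" using S by auto
  then have "card S \<ge> 1" using S(1) by (simp add: Suc_le_eq card_gt_0_iff)
  obtain q where q: "\<And>y. y \<in> S \<Longrightarrow> q y \<in> X \<and> G (q y) = y"
  proof -
    have "\<forall>y\<in>S. \<exists>t. t \<in> X \<and> G t = y" using S(2) by blast
    from bchoice[OF this] that show ?thesis by blast
  qed
  obtain \<sigma> where \<sigma>: "bij_betw \<sigma> {1..card S} S"
    using ex_bij_betw_nat_finite_1[OF S(1)] by blast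
  then have \<sigma>S: "\<sigma> j \<in> S" if "j \<in> {1..card S}" for j using that bij_betwE by blast
  have "x = (\<Sum>j=1..card S. u (\<sigma> j) *\<^sub>R \<sigma> j)"
    using sum.reindex_bij_betw[OF \<sigma>, of "\<lambda>y. u y *\<^sub>R y"] u by simp
  also have "\<dots> = (\<Sum>j=1..card S. u (\<sigma> j) *\<^sub>R G (q (\<sigma> j)))"
    using q \<sigma>S by (intro sum.cong) auto
  finally show ?thesis
    using \<open>card S \<ge> 1\<close> S(3) q \<sigma>S u(1) by (intro that[of "card S" "\<lambda>j. q (\<sigma> j)" "\<lambda>j. u (\<sigma> j)"]) auto
qed

subsection \<open>The first-order condition\<close>

lemma has_derivative_dir_quotient:
  fixes \<phi> :: "'a::real_normed_vector \<Rightarrow> real"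
  assumes "(\<phi> has_derivative \<phi>') (at x)"
  shows "((\<lambda>t. (\<phi> (x + t *\<^sub>R h) - \<phi> x) / t) \<longlongrightarrow> \<phi>' h) (at_right 0)"
proof -
  interpret bounded_linear \<phi>' using assms has_derivative_bounded_linear by blast
  have "((\<lambda>t. \<phi> (x + t *\<^sub>R h)) has_derivative (\<lambda>t. \<phi>' (t *\<^sub>R h))) (at 0)"
    by (rule has_derivative_compose[of "\<lambda>t. x + t *\<^sub>R h" "\<lambda>t. t *\<^sub>R h" 0 UNIV \<phi> \<phi>'])
      (use assms in \<open>auto intro!: derivative_eq_intros\<close>)
  then have "((\<lambda>t. \<phi> (x + t *\<^sub>R h)) has_field_derivative \<phi>' h) (at 0)"
    by (simp add: has_field_derivative_def scaleR mult.commute[of _ "\<phi>' h"])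
  then have "((\<lambda>t. (\<phi> (x + t *\<^sub>R h) - \<phi> x) / t) \<longlongrightarrow> \<phi>' h) (at 0)"
    by (simp add: has_field_derivative_iff)
  then show ?thesis by (rule filterlim_mono) (auto simp: at_le)
qed

text \<open>Homogeneity removes the positive factors \<open>tn n\<close>, and continuity passes to
  the limit direction.\<close>

lemma nonneg_on_contingent_cone:
  fixes \<Lambda> :: "'a::real_normed_vector \<Rightarrow> real"
  assumes "bounded_linear \<Lambda>" and nonneg: "\<And>k. x + k \<in> A \<Longrightarrow> 0 \<le> \<Lambda> k"
    and h: "h \<in> contingent_cone A x"
  shows "0 \<le> \<Lambda> h"
proof -
  interpret bounded_linear \<Lambda> by fact
  obtain tn hn where tn: "\<And>n. tn n > (0::real)" and hn: "hn \<longlonglongrightarrow> h" "\<And>n. x + tn n *\<^sub>R hn n \<in> A"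
    using h unfolding contingent_cone_def by blast
  have "0 \<le> \<Lambda> (hn n)" for n
    using nonneg[OF hn(2)[of n]] tn[of n] by (simp add: scaleR zero_le_mult_iff)
  moreover have "(\<lambda>n. \<Lambda> (hn n)) \<longlonglongrightarrow> \<Lambda> h" by (rule tendsto[OF hn(1)])
  ultimately show ?thesis by (intro LIMSEQ_le_const) auto
qed

lemma sum_disc_idx:
  assumes "finite I"
  shows "(\<Sum>(i,j)\<in>disc_idx I m. F i j) = (\<Sum>i\<in>I. \<Sum>j=1..m i. F i j)"
proof -
  have "disc_idx I m = Sigma I (\<lambda>i. {1..m i})" by (auto simp: disc_idx_def)
  then show ?thesis using assms by (simp add: sum.Sigma)
qed

lemma finite_active_idx: "finite (active_idx g l T x)"
  by (simp add: active_idx_def)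

lemma sum_nonpos_zeroD:
  fixes h :: "'i \<Rightarrow> real"
  assumes "finite I" "\<And>i. i \<in> I \<Longrightarrow> h i \<le> 0" "0 \<le> sum h I" "i \<in> I"
  shows "h i = 0"
  using assms sum_nonneg_eq_0_iff[of I "\<lambda>i. - h i"] sum_nonpos[of I h] by (force simp: sum_negf)

text \<open>The hypotheses \<open>restore\<close> and \<open>M_closed\<close> isolate what the
  equality constraint has to provide, so the regular case and the case b = 0 are both instances. The
  vector \<open>k\<close> is a Slater direction for the linearised inequalities.\<close>

lemma disc_multiplier_of_local_opt:
  fixes A :: "'a::euclidean_space set" and W :: "'w::t2_space set"
    and f :: "'a \<Rightarrow> 'w \<Rightarrow> real" and fx :: "'a \<Rightarrow> 'w \<Rightarrow> 'a"
    and b :: "'a \<Rightarrow> 'b::euclidean_space" and B :: "'a \<Rightarrow> 'b"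
    and T :: "'t::metric_space set" and l :: nat
    and g :: "nat \<Rightarrow> 'a \<Rightarrow> 't \<Rightarrow> real" and gx :: "nat \<Rightarrow> 'a \<Rightarrow> 't \<Rightarrow> 'a"
  assumes A: "closed A" "convex A"
    and W: "compact W" "W \<noteq> {}"
    and f_cont: "continuous_on (UNIV \<times> W) (\<lambda>(x,w). f x w)"
    and f_deriv: "\<And>x w. w \<in> W \<Longrightarrow> ((\<lambda>x. f x w) has_derivative (\<lambda>h. inner (fx x w) h)) (at x)"
    and fx_cont: "continuous_on (UNIV \<times> W) (\<lambda>(x,w). fx x w)"
    and b_deriv: "(b has_derivative B) (at xs)"
    and T: "compact T"
    and g_cont: "\<And>i. i \<in> {1..l} \<Longrightarrow> continuous_on (UNIV \<times> T) (\<lambda>(x,t). g i x t)"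
    and g_deriv: "\<And>i x t. i \<in> {1..l} \<Longrightarrow> t \<in> T \<Longrightarrow>
                    ((\<lambda>x. g i x t) has_derivative (\<lambda>h. inner (gx i x t) h)) (at x)"
    and gx_cont: "\<And>i. i \<in> {1..l} \<Longrightarrow> continuous_on (UNIV \<times> T) (\<lambda>(x,t). gx i x t)"
    and opt: "sip_local_opt f W A g l T b xs"
    and restore: "\<And>h \<eta>. xs + h \<in> A \<Longrightarrow> B h = 0 \<Longrightarrow> \<eta> > 0 \<Longrightarrow>
      \<exists>\<delta>>0. \<forall>t. 0 < t \<and> t < \<delta> \<longrightarrow>
        (\<exists>y. norm y \<le> \<eta> * t \<and> xs + t *\<^sub>R h + y \<in> A \<and> b (xs + t *\<^sub>R h + y) = 0)"
    and M_closed: "closed (multiplier_cone {h. xs + h \<in> A} B)"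
    and k: "xs + k \<in> A" "B k = 0" "\<And>i t. i \<in> {1..l} \<Longrightarrow> t \<in> T \<Longrightarrow> g i xs t + gx i xs t \<bullet> k < 0"
  shows "\<exists>m tt lam \<nu>. disc_choice DIM('a) g l T xs m tt \<and>
    disc_lagrange_mult f W A g (active_idx g l T xs) m tt b xs lam \<nu>"
proof -
  interpret B: bounded_linear B using b_deriv has_derivative_bounded_linear by blast
  note cf = continuous_on_section[OF f_cont]
  let ?F = "maxF f W"
  define C where "C = {h. xs + h \<in> A}"
  have xs: "xs \<in> A" "\<And>i t. i \<in> {1..l} \<Longrightarrow> t \<in> T \<Longrightarrow> g i xs t \<le> 0" "b xs = 0"
    using opt by (auto simp: sip_local_opt_def sip_feasible_def)
  have C: "closed C" "convex C" "0 \<in> C"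
  proof -
    have "C = (\<lambda>a. a - xs) ` A" unfolding C_def by (force simp: image_iff)
    then show "closed C" "convex C"
      using A closed_translation_subtract[of A xs] convex_translation_subtract[of A xs] by simp_all
  qed (use xs in \<open>auto simp: C_def\<close>)
  \<comment> \<open>Constraint indices start at 1, which leaves index 0 for the objective.
    Subtracting the maximum makes its values nonpositive and zero exactly at the maximisers, so it
    behaves like one more constraint.\<close>
  define P where "P i = (if i = 0 then (\<lambda>w. (fx xs w, f xs w - ?F xs)) ` W
     else (\<lambda>t. (gx i xs t, g i xs t)) ` T)" for i
  have P_le: "snd q \<le> 0" if "q \<in> P i" "i \<in> {0..l}" for i q
    using that maxF_upper[of W f xs, OF W(1) cf] xs(2)[of i] by (auto simp: P_def split: if_splits)
  have P_compact: "compact (P i)" if "i \<in> {0..l}" for i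
  proof (cases "i = 0")
    case True
    then show ?thesis unfolding P_def
      using continuous_on_section[OF fx_cont] cf W by (auto intro!: compact_continuous_image continuous_intros)
  next
    case False
    then have "i \<in> {1..l}" using that by auto
    then have "compact ((\<lambda>t. (gx i xs t, g i xs t)) ` T)"
      by (intro compact_continuous_image continuous_on_Pair T
          continuous_on_section[OF gx_cont] continuous_on_section[OF g_cont])
    then show ?thesis using False by (simp add: P_def)
  qed
  define Q where "Q = convex hull (\<Union>i\<in>{0..l}. P i)"
  have Q: "compact Q" "convex Q" "Q \<noteq> {}"
  proof -
    have "compact (\<Union>i\<in>{0..l}. P i)" using P_compact by (intro compact_UN) auto
    then show "compact Q" "convex Q" by (auto simp: Q_def compact_convex_hull)
    show "Q \<noteq> {}" using W by (force simp: Q_def P_def)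
  qed
  \<comment> \<open>If every member of \<open>Q\<close> were negative at \<open>h\<close>, all
    families would decrease strictly along \<open>h\<close>; after restoration of b = 0 this yields
    feasible points near \<open>xs\<close> with a smaller objective.\<close>
  have incons: "\<exists>q\<in>Q. 0 \<le> fst q \<bullet> h + snd q" if h: "h \<in> C" "B h = 0" for h
  proof (rule ccontr)
    assume "\<not> ?thesis"
    then have neg: "fst q \<bullet> h + snd q < 0" if "q \<in> P i" "i \<in> {0..l}" for q i
      using that hull_inc[of q "\<Union>i\<in>{0..l}. P i" convex] by (force simp: Q_def)
    have f_neg: "f xs w + fx xs w \<bullet> h < ?F xs" if "w \<in> W" for w
      using neg[of "(fx xs w, f xs w - ?F xs)" 0] that by (auto simp: P_def)
    have g_neg: "g i xs t + gx i xs t \<bullet> h < 0" if "i \<in> {1..l}" "t \<in> T" for i t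
      using neg[of "(gx i xs t, g i xs t)" i] that by (auto simp: P_def)
    obtain \<eta>0 \<delta>0 where e0: "\<eta>0 > 0" "\<delta>0 > 0"
      "\<And>t y w. 0 < t \<Longrightarrow> t < \<delta>0 \<Longrightarrow> norm y \<le> \<eta>0 * t \<Longrightarrow> w \<in> W \<Longrightarrow> f (xs + t *\<^sub>R h + y) w < ?F xs"
      using uniform_descent[OF W(1) f_cont f_deriv fx_cont maxF_upper[of W f xs, OF W(1) cf] f_neg] by blast
    have "\<exists>\<epsilon>>0. \<forall>t y s. 0 < t \<and> t < \<epsilon> \<and> norm y \<le> \<epsilon> * t \<and> s \<in> T \<longrightarrow> g i (xs + t *\<^sub>R h + y) s < 0"
      if i: "i \<in> {1..l}" for i
    proof -
      obtain \<eta> \<delta> where e: "\<eta> > 0" "\<delta> > 0"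
        "\<And>t y s. 0 < t \<Longrightarrow> t < \<delta> \<Longrightarrow> norm y \<le> \<eta> * t \<Longrightarrow> s \<in> T \<Longrightarrow> g i (xs + t *\<^sub>R h + y) s < 0"
        using uniform_descent[OF T g_cont[OF i] g_deriv[OF i] gx_cont[OF i] xs(2)[OF i] g_neg[OF i]] by blast
      have "norm y \<le> \<eta> * t" if "norm y \<le> min \<eta> \<delta> * t" "0 < t" for y :: 'a and t
        using that mult_right_mono[of "min \<eta> \<delta>" \<eta> t] by linarith
      then show ?thesis using e by (intro exI[of _ "min \<eta> \<delta>"]) auto
    qed
    then obtain \<epsilon> where \<epsilon>: "\<And>i. i \<in> {1..l} \<Longrightarrow> \<epsilon> i > 0"
      "\<And>i t y s. i \<in> {1..l} \<Longrightarrow> 0 < t \<Longrightarrow> t < \<epsilon> i \<Longrightarrow> norm y \<le> \<epsilon> i * t \<Longrightarrow> s \<in> T \<Longrightarrow> g i (xs + t *\<^sub>R h + y) s < 0"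
      by metis
    \<comment> \<open>One number bounds both the step length and the relative size of the correction
      for all families. The inserted elements keep the set nonempty when
      \<open>l = 0\<close>.\<close>
    define \<gamma> where "\<gamma> = Min (insert \<eta>0 (insert \<delta>0 (\<epsilon> ` {1..l})))"
    have "\<gamma> > 0" using e0 \<epsilon>(1) by (auto simp: \<gamma>_def)
    moreover have "\<gamma> \<le> r" if "r \<in> insert \<eta>0 (insert \<delta>0 (\<epsilon> ` {1..l}))" for r
      unfolding \<gamma>_def by (rule Min_le) (use that in auto)
    ultimately have \<gamma>: "\<gamma> > 0" "\<gamma> \<le> \<eta>0" "\<gamma> \<le> \<delta>0" "\<And>i. i \<in> {1..l} \<Longrightarrow> \<gamma> \<le> \<epsilon> i"
      by auto
    obtain \<delta> where \<delta>: "\<delta> > 0" "\<And>t. 0 < t \<Longrightarrow> t < \<delta> \<Longrightarrow>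
      \<exists>y. norm y \<le> \<gamma> * t \<and> xs + t *\<^sub>R h + y \<in> A \<and> b (xs + t *\<^sub>R h + y) = 0"
      using restore[of h \<gamma>] h \<gamma>(1) by (auto simp: C_def)
    obtain e where e: "e > 0" "\<And>x. sip_feasible A g l T b x \<Longrightarrow> dist x xs < e \<Longrightarrow> ?F xs \<le> ?F x"
      using opt by (auto simp: sip_local_opt_def)
    define c where "c = norm h + \<gamma> + 1"
    have c: "c > 0" using \<gamma> by (simp add: c_def add_nonneg_pos)
    have "0 < min (min \<delta> \<gamma>) (e / c)" using e c \<delta> \<gamma> by simp
    then obtain t where t: "0 < t" "t < \<delta>" "t < \<gamma>" "t < e / c"
      using dense by (metis min_less_iff_conj)
    obtain y where y: "norm y \<le> \<gamma> * t" "xs + t *\<^sub>R h + y \<in> A" "b (xs + t *\<^sub>R h + y) = 0"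
      using \<delta>(2)[OF t(1,2)] by blast
    let ?x = "xs + t *\<^sub>R h + y"
    have ny: "norm y \<le> \<gamma>' * t" if "\<gamma> \<le> \<gamma>'" for \<gamma>'
      using y(1) mult_right_mono[OF that, of t] t by linarith
    have "g i ?x s \<le> 0" if "i \<in> {1..l}" "s \<in> T" for i s
      using \<epsilon>(2)[OF that(1) t(1) _ ny[OF \<gamma>(4)] that(2)] \<gamma>(4)[OF that(1)] t that by force
    then have "sip_feasible A g l T b ?x" using y by (auto simp: sip_feasible_def)
    moreover have "dist ?x xs < e"
    proof -
      have "dist ?x xs \<le> norm (t *\<^sub>R h) + norm y"
        using norm_triangle_ineq[of "t *\<^sub>R h" y] by (simp add: dist_norm add.assoc)
      also have "\<dots> \<le> t * c" using y t by (simp add: c_def algebra_simps)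
      also have "\<dots> < e" using t c by (simp add: pos_less_divide_eq)
      finally show ?thesis .
    qed
    ultimately have "?F xs \<le> ?F ?x" by (rule e(2))
    moreover obtain w where "w \<in> W" "f ?x w = ?F ?x"
      using maxF_attained[of W f ?x, OF W cf] by blast
    ultimately show False using e0(3)[OF t(1) _ ny[OF \<gamma>(2)], of w] t \<gamma>(3) by force
  qed
  obtain q \<nu> where q: "q \<in> Q" and q_nonneg: "\<And>h. h \<in> C \<Longrightarrow> 0 \<le> fst q \<bullet> h + \<nu> \<bullet> B h + snd q"
    using multiplier_exists[OF C B.linear_axioms M_closed[folded C_def] Q incons]
    by (fastforce simp: multiplier_cone_def)
  obtain \<theta> s where \<theta>: "\<And>i. i \<in> {0..l} \<Longrightarrow> 0 \<le> \<theta> i" "sum \<theta> {0..l} = 1"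
    and s: "\<And>i. i \<in> {0..l} \<Longrightarrow> \<theta> i > 0 \<Longrightarrow> s i \<in> convex hull P i" and q_eq: "q = (\<Sum>i\<in>{0..l}. \<theta> i *\<^sub>R s i)"
    using q unfolding Q_def by (rule convex_hull_UN_split[OF finite_atLeastAtMost]) (rule that)
  have fst_q: "fst q = (\<Sum>i\<in>{0..l}. \<theta> i *\<^sub>R fst (s i))" and snd_q: "snd q = (\<Sum>i\<in>{0..l}. \<theta> i * snd (s i))"
    by (simp_all add: q_eq fst_sum snd_sum)
  have hull_neg: "c \<bullet> q' \<le> r" if "q' \<in> convex hull P'" "\<And>q. q \<in> P' \<Longrightarrow> c \<bullet> q \<le> r" for c q' r and P' :: "'c::real_inner set"
    using hull_minimal[of P' "{q. c \<bullet> q \<le> r}" convex] that convex_halfspace_le by auto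
  have s_le: "snd (s i) \<le> 0" if i: "i \<in> {0..l}" "\<theta> i > 0" for i
    using hull_neg[OF s[OF i], of "(0,1)" 0] P_le i by (simp add: inner_prod_def)
  \<comment> \<open>Complementarity: at h = 0 the multiplier inequality says that the sum of these
    nonpositive terms is nonnegative.\<close>
  have "\<theta> i * snd (s i) = 0" if i: "i \<in> {0..l}" for i
  proof -
    have le: "\<theta> i * snd (s i) \<le> 0" if "i \<in> {0..l}" for i
      using s_le[OF that] \<theta>(1)[OF that] by (cases "\<theta> i = 0") (auto simp: mult_le_0_iff)
    have "0 \<le> (\<Sum>i\<in>{0..l}. \<theta> i * snd (s i))" using q_nonneg[OF C(3)] by (simp add: snd_q B.zero)
    then show ?thesis using sum_nonpos_zeroD[of "{0..l}" "\<lambda>i. \<theta> i * snd (s i)"] le i by blast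
  qed
  then have snd_s: "snd (s i) = 0" if "i \<in> {0..l}" "\<theta> i > 0" for i using that by force
  then have snd_q0: "snd q = 0" unfolding snd_q using \<theta>(1) by (intro sum.neutral) force
  have v: "fst (s i) \<in> convex hull {u. (u, 0) \<in> P i}" if i: "i \<in> {0..l}" "\<theta> i > 0" for i
    using convex_hull_supporting_level[of "fst (s i)" "P i"] s[OF i] snd_s[OF i] P_le i
    by (metis prod.collapse)
  \<comment> \<open>Suppose the objective has weight 0. At \<open>k\<close> every other family of
    positive weight has a strictly negative slope, because its values are 0 there, and
    \<open>B k = 0\<close> removes the equality term. Nonnegativity then forces all weights to
    vanish, although they sum to 1.\<close>
  have \<theta>0: "\<theta> 0 > 0"
  proof (rule ccontr)
    assume "\<not> \<theta> 0 > 0"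
    then have z: "\<theta> 0 = 0" using \<theta>(1)[of 0] by simp
    have lt: "fst (s i) \<bullet> k < 0" if "i \<in> {0..l}" "\<theta> i > 0" for i
    proof -
      have i: "i \<in> {1..l}" "\<theta> i > 0" using that z by (auto simp: Suc_le_eq intro: gr0I)
      have "fst (s i) \<in> convex hull {u. (u, 0) \<in> P i}" using v i by auto
      moreover have "convex hull {u. (u, 0) \<in> P i} \<subseteq> {u. k \<bullet> u < 0}"
      proof (rule hull_minimal)
        show "{u. (u, 0) \<in> P i} \<subseteq> {u. k \<bullet> u < 0}"
          using i k(3)[OF i(1)] by (force simp: P_def inner_commute)
      qed (rule convex_halfspace_lt)
      ultimately show ?thesis by (auto simp: inner_commute)
    qed
    have le: "\<theta> i * (fst (s i) \<bullet> k) \<le> 0" if "i \<in> {0..l}" for i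
      using lt[of i] \<theta>(1)[OF that] that z by (cases "\<theta> i = 0") (auto simp: mult_le_0_iff intro: less_imp_le)
    moreover have "0 \<le> (\<Sum>i\<in>{0..l}. \<theta> i * (fst (s i) \<bullet> k))"
      using q_nonneg[of k] k snd_q0 by (simp add: C_def fst_q inner_sum_left)
    ultimately have "\<theta> i * (fst (s i) \<bullet> k) = 0" if "i \<in> {0..l}" for i
      using sum_nonpos_zeroD[of "{0..l}" "\<lambda>i. \<theta> i * (fst (s i) \<bullet> k)"] that by blast
    then have "\<theta> i = 0" if "i \<in> {0..l}" for i
      using lt[of i] \<theta>(1)[OF that] that by force
    then show False using \<theta>(2) by simp
  qed
  let ?I = "active_idx g l T xs"
  have active: "i \<in> ?I" if "i \<in> {1..l}" "active_pts g i T xs \<noteq> {}" for i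
    using that xs(2) by (auto simp: active_idx_def active_pts_def)
  have level: "{u. (u, 0) \<in> P i} = gx i xs ` active_pts g i T xs" if "i \<in> {1..l}" for i
    using that by (auto simp: P_def active_pts_def)
  \<comment> \<open>At an inactive index no constraint value is 0, so the hull that would contain
    \<open>fst (s i)\<close> is empty.\<close>
  have inactive: "\<theta> i = 0" if "i \<in> {1..l}" "i \<notin> ?I" for i
  proof (rule ccontr)
    assume "\<theta> i \<noteq> 0"
    then have "fst (s i) \<in> convex hull (gx i xs ` active_pts g i T xs)"
      using v[of i] \<theta>(1)[of i] that level[of i] by force
    then show False using active[of i] that by force
  qed
  define carath where "carath i m p c \<longleftrightarrow> m \<in> {1..DIM('a) + 1} \<and> (\<forall>j\<in>{1..m}. p j \<in> active_pts g i T xs \<and> 0 \<le> c j) \<and>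
      \<theta> i *\<^sub>R fst (s i) = (\<Sum>j=1..m. c j *\<^sub>R gx i xs (p j))" for i m p and c :: "nat \<Rightarrow> real"
  have "\<exists>m p c. carath i m p c" if i: "i \<in> ?I" for i
  proof (cases "\<theta> i = 0")
    case True
    \<comment> \<open>\<open>disc_choice\<close> demands a point for every active index, even one of
      weight 0; an arbitrary active point with coefficient 0 serves.\<close>
    obtain t where "t \<in> active_pts g i T xs" using i by (auto simp: active_idx_def active_pts_def)
    with True show ?thesis by (intro exI[of _ 1] exI[of _ "\<lambda>_. t"] exI[of _ "\<lambda>_. 0"]) (auto simp: carath_def)
  next
    case False
    have il: "i \<in> {1..l}" using i by (simp add: active_idx_def)
    have pos: "\<theta> i > 0" using False \<theta>(1)[of i] il by auto
    have "fst (s i) \<in> convex hull (gx i xs ` active_pts g i T xs)"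
      using v[of i] pos il level[OF il] by auto
    then obtain m p c where mpc: "m \<in> {1..DIM('a) + 1}" "\<And>j. j \<in> {1..m} \<Longrightarrow> p j \<in> active_pts g i T xs \<and> 0 \<le> c j"
      "fst (s i) = (\<Sum>j=1..m. c j *\<^sub>R gx i xs (p j))"
      by (rule caratheodory_indexed) (rule that)
    then show ?thesis using pos
      by (intro exI[of _ m] exI[of _ p] exI[of _ "\<lambda>j. \<theta> i * c j"]) (auto simp: carath_def scaleR_right.sum)
  qed
  then obtain m tt c where "\<And>i. i \<in> ?I \<Longrightarrow> carath i (m i) (tt i) (c i)"
    by metis
  then have m: "\<And>i. i \<in> ?I \<Longrightarrow> m i \<in> {1..DIM('a) + 1}"
    and tt: "\<And>i j. i \<in> ?I \<Longrightarrow> j \<in> {1..m i} \<Longrightarrow> tt i j \<in> active_pts g i T xs"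
    and c: "\<And>i j. i \<in> ?I \<Longrightarrow> j \<in> {1..m i} \<Longrightarrow> 0 \<le> c i j"
    and comb: "\<And>i. i \<in> ?I \<Longrightarrow> \<theta> i *\<^sub>R fst (s i) = (\<Sum>j=1..m i. c i j *\<^sub>R gx i xs (tt i j))"
    unfolding carath_def by blast+
  \<comment> \<open>Division by the positive weight of the objective normalises its coefficient to
    1.\<close>
  define lam where "lam = (\<lambda>(i,j). c i j / \<theta> 0)"
  define \<nu>' where "\<nu>' = \<nu> /\<^sub>R \<theta> 0"
  define R where "R x = (\<Sum>(i,j)\<in>disc_idx ?I m. lam (i,j) * g i x (tt i j)) + \<nu>' \<bullet> b x" for x
  define R' where "R' h = (\<Sum>(i,j)\<in>disc_idx ?I m. lam (i,j) * (gx i xs (tt i j) \<bullet> h)) + \<nu>' \<bullet> B h" for h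
  have R_deriv: "(R has_derivative R') (at xs)"
  proof -
    have d: "((\<lambda>x. g i x (tt i j)) has_derivative (\<lambda>h. gx i xs (tt i j) \<bullet> h)) (at xs)" if "(i,j) \<in> disc_idx ?I m" for i j
      using that tt[of i j] by (intro g_deriv) (auto simp: disc_idx_def active_idx_def active_pts_def)
    show ?thesis unfolding R_def R'_def split_beta
      by (intro has_derivative_add has_derivative_sum has_derivative_mult_right has_derivative_inner_right b_deriv)
        (use d in auto)
  qed
  \<comment> \<open>The max function is replaced by \<open>fst (s 0)\<close>, a convex combination
    of gradients at maximisers. The directional derivative of the max function dominates it, so
    nonnegativity of \<Lambda> on the contingent cone suffices.\<close>
  define \<Lambda> where "\<Lambda> h = fst (s 0) \<bullet> h + R' h" for h
  have \<Lambda>: "bounded_linear \<Lambda>"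
    unfolding \<Lambda>_def using has_derivative_bounded_linear[OF R_deriv]
    by (intro bounded_linear_add bounded_linear_inner_right)
  have \<Lambda>_nonneg: "0 \<le> \<Lambda> h" if h: "xs + h \<in> A" for h
  proof -
    have "\<theta> 0 * R' h = (\<Sum>i\<in>?I. (\<Sum>j=1..m i. c i j *\<^sub>R gx i xs (tt i j)) \<bullet> h) + \<nu> \<bullet> B h"
      unfolding R'_def sum_disc_idx[OF finite_active_idx] distrib_left sum_distrib_left
      using \<theta>0 by (simp add: lam_def \<nu>'_def inner_sum_left)
    also have "(\<Sum>i\<in>?I. (\<Sum>j=1..m i. c i j *\<^sub>R gx i xs (tt i j)) \<bullet> h) = (\<Sum>i\<in>?I. \<theta> i * (fst (s i) \<bullet> h))"
      using comb by (intro sum.cong) (auto simp flip: inner_scaleR_left)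
    also have "\<dots> = (\<Sum>i\<in>{1..l}. \<theta> i * (fst (s i) \<bullet> h))"
      by (intro sum.mono_neutral_left) (auto simp: active_idx_def inactive)
    finally have "\<theta> 0 * \<Lambda> h = fst q \<bullet> h + \<nu> \<bullet> B h + snd q"
      unfolding \<Lambda>_def fst_q snd_q0 distrib_left
      by (simp add: sum.atLeast_Suc_atMost[of 0 l] inner_sum_left inner_add_left)
    then have "0 \<le> \<theta> 0 * \<Lambda> h" using q_nonneg[of h] h by (simp add: C_def)
    then show ?thesis using \<theta>0 by (simp add: zero_le_mult_iff)
  qed
  have "nonneg_dir_deriv (\<lambda>x. ?F x + (\<Sum>(i,j)\<in>disc_idx ?I m. lam (i,j) * g i x (tt i j)) + \<nu>' \<bullet> b x) xs h"
    if h: "h \<in> contingent_cone A xs" for h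
  proof -
    obtain D where D: "((\<lambda>t. (?F (xs + t *\<^sub>R h) - ?F xs) / t) \<longlongrightarrow> D) (at_right 0)"
      and D_ge: "\<And>w. w \<in> W \<Longrightarrow> f xs w = ?F xs \<Longrightarrow> fx xs w \<bullet> h \<le> D"
      using maxF_dir_deriv[OF W f_cont f_deriv fx_cont] by blast
    have "fst (s 0) \<in> convex hull {u. (u, 0) \<in> P 0}" using v[of 0] \<theta>0 by simp
    then have "h \<bullet> fst (s 0) \<le> D"
      by (rule hull_neg) (use D_ge in \<open>auto simp: P_def inner_commute\<close>)
    then have "D + R' h \<ge> 0"
      using nonneg_on_contingent_cone[OF \<Lambda> \<Lambda>_nonneg h] by (simp add: \<Lambda>_def inner_commute)
    moreover have "((\<lambda>t. (?F (xs + t *\<^sub>R h) - ?F xs) / t + (R (xs + t *\<^sub>R h) - R xs) / t) \<longlongrightarrow> D + R' h) (at_right 0)"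
      by (intro tendsto_add D has_derivative_dir_quotient R_deriv)
    ultimately show ?thesis
      unfolding nonneg_dir_deriv_def R_def by (intro exI[of _ "D + R' h"]) (simp add: add_divide_distrib diff_divide_distrib algebra_simps)
  qed
  moreover have "0 \<le> lam (i,j) \<and> lam (i,j) * g i xs (tt i j) = 0" if "(i,j) \<in> disc_idx ?I m" for i j
    using that c[of i j] tt[of i j] \<theta>0 by (auto simp: disc_idx_def lam_def active_pts_def)
  moreover have "disc_choice DIM('a) g l T xs m tt"
    using m tt by (simp add: disc_choice_def)
  ultimately show ?thesis
    unfolding disc_lagrange_mult_def by blast
qed

subsection \<open>Discrete measures\<close>

text \<open>As a push-forward from the index set, the measure adds up the weights of coinciding
  points by itself and lives on the Borel sets relative to \<open>T\<close>.\<close>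

definition discrete_measure :: "'t::metric_space set \<Rightarrow> nat \<Rightarrow> (nat \<Rightarrow> 't) \<Rightarrow> (nat \<Rightarrow> real) \<Rightarrow> 't measure" where
  "discrete_measure T m p c = distr (point_measure {..<m} (\<lambda>j. ennreal (c j))) (restrict_space borel T) p"

lemma emeasure_discrete_measure:
  assumes p: "\<And>j. j < m \<Longrightarrow> p j \<in> T" and S: "S \<in> sets (restrict_space borel T)"
  shows "emeasure (discrete_measure T m p c) S = (\<Sum>j<m. ennreal (c j) * indicator S (p j))"
proof -
  have "p \<in> point_measure {..<m} (\<lambda>j. ennreal (c j)) \<rightarrow>\<^sub>M restrict_space borel T"
    using p by (simp add: measurable_point_measure_eq1 space_restrict_space)
  then have "emeasure (discrete_measure T m p c) S = (\<Sum>j\<in>p -` S \<inter> {..<m}. ennreal (c j))"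
    using S by (simp add: discrete_measure_def emeasure_distr space_point_measure emeasure_point_measure_finite)
  also have "\<dots> = (\<Sum>j<m. ennreal (c j) * indicator S (p j))"
    by (intro sum.mono_neutral_cong_left) (auto simp: indicator_def)
  finally show ?thesis .
qed

lemma integral_discrete_measure:
  fixes \<phi> :: "'t::metric_space \<Rightarrow> real"
  assumes p: "\<And>j. j < m \<Longrightarrow> p j \<in> T \<and> 0 \<le> c j" and \<phi>: "continuous_on T \<phi>"
  shows "integral\<^sup>L (discrete_measure T m p c) \<phi> = (\<Sum>j<m. c j * \<phi> (p j))"
proof -
  have "p \<in> point_measure {..<m} (\<lambda>j. ennreal (c j)) \<rightarrow>\<^sub>M restrict_space borel T"
    using p by (simp add: measurable_point_measure_eq1 space_restrict_space)
  moreover have "\<phi> \<in> borel_measurable (restrict_space borel T)"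
    by (rule borel_measurable_continuous_on_restrict[OF \<phi>])
  ultimately have "integral\<^sup>L (discrete_measure T m p c) \<phi> = integral\<^sup>L (point_measure {..<m} (\<lambda>j. ennreal (c j))) (\<lambda>j. \<phi> (p j))"
    unfolding discrete_measure_def by (rule integral_distr)
  also have "\<dots> = (\<Sum>j<m. c j * \<phi> (p j))"
    using p by (subst lebesgue_integral_point_measure_finite) auto
  finally show ?thesis .
qed

lemma discrete_measure_props:
  assumes p: "\<And>j. j < m \<Longrightarrow> p j \<in> T \<and> 0 \<le> c j"
  shows "rca_plus T (discrete_measure T m p c)" "is_discrete_meas T (discrete_measure T m p c) m p c"
proof -
  have sets: "sets (discrete_measure T m p c) = sets (restrict_space borel T)"
    by (simp add: discrete_measure_def)
  have em: "emeasure (discrete_measure T m p c) S = (\<Sum>j<m. ennreal (c j) * indicator S (p j))"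
    if "S \<in> sets (restrict_space borel T)" for S
    using emeasure_discrete_measure[OF _ that] p by blast
  have "T \<in> sets (restrict_space borel T)" by (auto simp: sets_restrict_space)
  from em[OF this] show "rca_plus T (discrete_measure T m p c)"
    unfolding rca_plus_def using sets by (auto simp: indicator_def ennreal_mult_less_top)
  show "is_discrete_meas T (discrete_measure T m p c) m p c"
    unfolding is_discrete_meas_def using p em sets by auto
qed

text \<open>The atoms prescribe the measure on its measurable sets and \<open>rca_plus\<close> fixes
  which sets these are. Integrals against any discrete multiplier thus become finite sums.\<close>

lemma is_discrete_meas_imp_eq:
  assumes "rca_plus T \<mu>" and "is_discrete_meas T \<mu> m p c"
  shows "\<mu> = discrete_measure T m p c"
proof (rule measure_eqI)
  show sets: "sets \<mu> = sets (discrete_measure T m p c)"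
    using assms(1) by (simp add: rca_plus_def discrete_measure_def)
  fix S assume S: "S \<in> sets \<mu>"
  then have "emeasure \<mu> S = (\<Sum>j<m. ennreal (c j) * indicator S (p j))"
    using assms(2) by (simp add: is_discrete_meas_def)
  also have "\<dots> = emeasure (discrete_measure T m p c) S"
    using S assms by (intro emeasure_discrete_measure[symmetric]) (auto simp: is_discrete_meas_def rca_plus_def)
  finally show "emeasure \<mu> S = emeasure (discrete_measure T m p c) S" .
qed

section \<open>Translation between discrete multipliers of (SIP) and multipliers of (D)\<close>

lemma sip_multiplier_of_disc_multiplier:
  fixes g :: "nat \<Rightarrow> 'a::euclidean_space \<Rightarrow> 't::metric_space \<Rightarrow> real" and b :: "'a \<Rightarrow> 'b::real_inner"
  assumes cont: "\<And>i x. i \<in> {1..l} \<Longrightarrow> continuous_on T (g i x)"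
    and choice: "disc_choice DIM('a) g l T xs m tt"
    and mult: "disc_lagrange_mult f W A g (active_idx g l T xs) m tt b xs lam \<nu>"
  shows "\<exists>\<mu> \<nu>. sip_discrete_lagrange_mult f W A g l T b xs \<mu> \<nu>"
proof -
  let ?I = "active_idx g l T xs"
  \<comment> \<open>Inactive indices receive the zero measure. Points of (D) are numbered from 1 and
    atoms from 0, hence the successors below.\<close>
  define n where "n i = (if i \<in> ?I then m i else 0)" for i
  define p where "p i j = tt i (Suc j)" for i j
  define c where "c i j = lam (i, Suc j)" for i j
  define \<mu> where "\<mu> i = discrete_measure T (n i) (p i) (c i)" for i
  have props: "p i j \<in> T \<and> 0 \<le> c i j" if "j < n i" for i j
    using that choice mult
    by (auto simp: n_def p_def c_def disc_choice_def disc_lagrange_mult_def disc_idx_def active_pts_def split: if_splits)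
  have int: "integral\<^sup>L (\<mu> i) (g i x) = (if i \<in> ?I then \<Sum>j=1..m i. lam (i,j) * g i x (tt i j) else 0)" if "i \<in> {1..l}" for i x
  proof -
    have "integral\<^sup>L (\<mu> i) (g i x) = (\<Sum>j<n i. c i j * g i x (p i j))"
      unfolding \<mu>_def by (intro integral_discrete_measure props cont[OF that])
    then show ?thesis by (simp add: n_def p_def c_def sum.atLeast1_atMost_eq)
  qed
  \<comment> \<open>The two Lagrangians agree as functions of \<open>x\<close>, so the directional
    condition carries over verbatim.\<close>
  have sum_int: "(\<Sum>i=1..l. integral\<^sup>L (\<mu> i) (g i x)) = (\<Sum>(i,j)\<in>disc_idx ?I m. lam (i,j) * g i x (tt i j))" for x
  proof -
    have "(\<Sum>i=1..l. integral\<^sup>L (\<mu> i) (g i x)) = (\<Sum>i\<in>?I. \<Sum>j=1..m i. lam (i,j) * g i x (tt i j))"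
      by (intro sum.mono_neutral_cong_right) (auto simp: active_idx_def int)
    then show ?thesis by (simp add: sum_disc_idx[OF finite_active_idx])
  qed
  have "sip_lagrange_mult f W A g l T b xs \<mu> \<nu>"
    unfolding sip_lagrange_mult_def sip_lagrangian_def sum_int
  proof (intro conjI ballI)
    show "rca_plus T (\<mu> i)" for i unfolding \<mu>_def by (rule discrete_measure_props(1)[OF props])
    show "(\<Sum>(i,j)\<in>disc_idx ?I m. lam (i,j) * g i xs (tt i j)) = 0"
      using mult by (intro sum.neutral) (auto simp: disc_lagrange_mult_def)
  qed (use mult in \<open>auto simp: disc_lagrange_mult_def\<close>)
  moreover have "n i \<le> DIM('a) + 1" for i
    using choice by (auto simp: n_def disc_choice_def)
  moreover have "is_discrete_meas T (\<mu> i) (n i) (p i) (c i)" for i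
    unfolding \<mu>_def by (rule discrete_measure_props(2)[OF props])
  ultimately show ?thesis unfolding sip_discrete_lagrange_mult_def by blast
qed

text \<open>Feasibility makes every term weight times constraint value nonpositive, so the vanishing
  total annihilates each of them. Atoms of nonzero weight therefore sit at active points, and
  dropping the inactive indices leaves the Lagrangian unchanged.\<close>

lemma disc_multiplier_of_sip_multiplier:
  fixes g :: "nat \<Rightarrow> 'a::euclidean_space \<Rightarrow> 't::metric_space \<Rightarrow> real" and b :: "'a \<Rightarrow> 'b::real_inner"
  assumes cont: "\<And>i x. i \<in> {1..l} \<Longrightarrow> continuous_on T (g i x)"
    and feas: "sip_feasible A g l T b xs"
    and mult: "sip_discrete_lagrange_mult f W A g l T b xs \<mu> \<nu>"
  shows "\<exists>m tt lam \<nu>. disc_choice DIM('a) g l T xs m tt \<and>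
    disc_lagrange_mult f W A g (active_idx g l T xs) m tt b xs lam \<nu>"
proof -
  let ?I = "active_idx g l T xs"
  have "\<forall>i\<in>{1..l}. \<exists>m p c. m \<le> DIM('a) + 1 \<and> is_discrete_meas T (\<mu> i) m p c"
    using mult by (simp add: sip_discrete_lagrange_mult_def)
  then obtain n p c where n: "\<And>i. i \<in> {1..l} \<Longrightarrow> n i \<le> DIM('a) + 1"
    and disc: "\<And>i. i \<in> {1..l} \<Longrightarrow> is_discrete_meas T (\<mu> i) (n i) (p i) (c i)"
    by metis
  have pc: "p i j \<in> T \<and> 0 \<le> c i j" if "i \<in> {1..l}" "j < n i" for i j
    using disc[OF that(1)] that(2) by (simp add: is_discrete_meas_def)
  have int: "integral\<^sup>L (\<mu> i) (g i x) = (\<Sum>j<n i. c i j * g i x (p i j))" if i: "i \<in> {1..l}" for i x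
  proof -
    have "rca_plus T (\<mu> i)"
      using mult i by (simp add: sip_discrete_lagrange_mult_def sip_lagrange_mult_def)
    from is_discrete_meas_imp_eq[OF this disc[OF i]] show ?thesis
      by (simp add: integral_discrete_measure[OF pc[OF i] cont[OF i]])
  qed
  have g_le: "g i xs t \<le> 0" if "i \<in> {1..l}" "t \<in> T" for i t
    using feas that by (simp add: sip_feasible_def)
  have term_le: "c i j * g i xs (p i j) \<le> 0" if "i \<in> {1..l}" "j < n i" for i j
    using pc[OF that] g_le[OF that(1)] by (simp add: mult_nonneg_nonpos)
  have compl: "c i j * g i xs (p i j) = 0" if i: "i \<in> {1..l}" and j: "j < n i" for i j
  proof -
    have "(\<Sum>i=1..l. \<Sum>j<n i. c i j * g i xs (p i j)) = 0"
      using mult int by (simp add: sip_discrete_lagrange_mult_def sip_lagrange_mult_def)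
    moreover have "(\<Sum>j<n i. c i j * g i xs (p i j)) \<le> 0" if "i \<in> {1..l}" for i
      using term_le that by (intro sum_nonpos) auto
    ultimately have "(\<Sum>j<n i. c i j * g i xs (p i j)) = 0"
      using sum_nonpos_zeroD[of "{1..l}" "\<lambda>i. \<Sum>j<n i. c i j * g i xs (p i j)" i] i by simp
    then show ?thesis
      using sum_nonpos_zeroD[of "{..<n i}" "\<lambda>j. c i j * g i xs (p i j)" j] term_le i j by simp
  qed
  have active_pt: "p i j \<in> active_pts g i T xs" if "i \<in> {1..l}" "j < n i" "c i j \<noteq> 0" for i j
    using compl[OF that(1,2)] pc[OF that(1,2)] that(3) by (simp add: active_pts_def)
  have inactive: "c i j = 0" if "i \<in> {1..l}" "i \<notin> ?I" "j < n i" for i j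
    using active_pt[OF that(1,3)] that(1,2) g_le by (force simp: active_idx_def active_pts_def)
  define t0 where "t0 i = (SOME t. t \<in> active_pts g i T xs)" for i
  have t0: "t0 i \<in> active_pts g i T xs" if "i \<in> ?I" for i
    unfolding t0_def by (rule someI_ex) (use that in \<open>auto simp: active_idx_def active_pts_def\<close>)
  \<comment> \<open>Atoms of weight zero may sit at inactive points; they are moved to \<open>t0 i\<close>, which also supplies
    the required point when \<open>n i = 0\<close>.\<close>
  define m where "m i = max 1 (n i)" for i
  define tt where "tt i j = (if j - 1 < n i \<and> c i (j - 1) \<noteq> 0 then p i (j - 1) else t0 i)" for i j
  define lam where "lam = (\<lambda>(i,j). if j - 1 < n i then c i (j - 1) else 0)"
  have sum_eq: "(\<Sum>j=1..m i. lam (i,j) * g i x (tt i j)) = (\<Sum>j<n i. c i j * g i x (p i j))" for i x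
  proof -
    have "(\<Sum>j=1..m i. lam (i,j) * g i x (tt i j)) = (\<Sum>j<m i. lam (i,Suc j) * g i x (tt i (Suc j)))"
      by (simp add: sum.atLeast1_atMost_eq)
    also have "\<dots> = (\<Sum>j<n i. c i j * g i x (p i j))"
      by (rule sum.mono_neutral_cong_right) (auto simp: m_def lam_def tt_def)
    finally show ?thesis .
  qed
  have lagr: "(\<Sum>i=1..l. integral\<^sup>L (\<mu> i) (g i x)) = (\<Sum>(i,j)\<in>disc_idx ?I m. lam (i,j) * g i x (tt i j))" for x
  proof -
    have "(\<Sum>j<n i. c i j * g i x (p i j)) = 0" if "i \<in> {1..l} - ?I" for i
      using inactive that by (intro sum.neutral) auto
    moreover have "?I \<subseteq> {1..l}" by (auto simp: active_idx_def)
    ultimately have "(\<Sum>i=1..l. integral\<^sup>L (\<mu> i) (g i x)) = (\<Sum>i\<in>?I. \<Sum>j<n i. c i j * g i x (p i j))"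
      by (intro sum.mono_neutral_cong_right) (auto simp: int)
    then show ?thesis unfolding sum_disc_idx[OF finite_active_idx] sum_eq .
  qed
  have tt_mem: "tt i j \<in> active_pts g i T xs" if "i \<in> ?I" for i j
    using t0[OF that] active_pt[of i "j - 1"] that by (auto simp: tt_def active_idx_def)
  have "disc_choice DIM('a) g l T xs m tt"
    unfolding disc_choice_def using tt_mem n by (auto simp: m_def active_idx_def)
  moreover have "disc_lagrange_mult f W A g ?I m tt b xs lam \<nu>"
    unfolding disc_lagrange_mult_def
  proof (intro conjI)
    show "\<forall>(i,j)\<in>disc_idx ?I m. 0 \<le> lam (i,j) \<and> lam (i,j) * g i xs (tt i j) = 0"
      using pc tt_mem by (fastforce simp: disc_idx_def lam_def active_idx_def active_pts_def)
    show "\<forall>h\<in>contingent_cone A xs. nonneg_dir_deriv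
        (\<lambda>x. maxF f W x + (\<Sum>(i,j)\<in>disc_idx ?I m. lam (i,j) * g i x (tt i j)) + inner \<nu> (b x)) xs h"
      using mult unfolding sip_discrete_lagrange_mult_def sip_lagrange_mult_def sip_lagrangian_def lagr by blast
  qed
  ultimately show ?thesis by blast
qed

subsection \<open>The convex case\<close>

text \<open>Convexity bounds the difference quotient for 0 < t < 1 by its value at t = 1.\<close>

lemma convex_dir_deriv_le:
  assumes conv: "convex_on UNIV \<phi>"
    and D: "((\<lambda>t. (\<phi> (x + t *\<^sub>R (y - x)) - \<phi> x) / t) \<longlongrightarrow> D) (at_right 0)"
  shows "D \<le> \<phi> y - \<phi> x"
proof (rule tendsto_upperbound[OF D])
  have "\<forall>\<^sub>F t :: real in at_right 0. 0 < t \<and> t < 1"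
    unfolding eventually_at_right_field by (rule exI[of _ 1]) auto
  then show "\<forall>\<^sub>F t in at_right 0. (\<phi> (x + t *\<^sub>R (y - x)) - \<phi> x) / t \<le> \<phi> y - \<phi> x"
  proof eventually_elim
    case (elim t)
    have "\<phi> ((1 - t) *\<^sub>R x + t *\<^sub>R y) \<le> (1 - t) * \<phi> x + t * \<phi> y"
      using elim by (intro convex_onD[OF conv]) auto
    moreover have "(1 - t) *\<^sub>R x + t *\<^sub>R y = x + t *\<^sub>R (y - x)" by (simp add: algebra_simps)
    ultimately show ?case using elim by (simp add: field_simps)
  qed
qed simp

lemma diff_mem_contingent_cone:
  assumes "convex A" "x \<in> A" "y \<in> A"
  shows "y - x \<in> contingent_cone A x"
proof -
  have "x + (1 / real (Suc n)) *\<^sub>R (y - x) \<in> A" for n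
  proof -
    have "(1 - 1 / real (Suc n)) *\<^sub>R x + (1 / real (Suc n)) *\<^sub>R y \<in> A"
      using assms by (intro convexD) auto
    then show ?thesis by (simp add: algebra_simps)
  qed
  moreover have "(\<lambda>n. 1 / real (Suc n)) \<longlonglongrightarrow> 0" by (rule LIMSEQ_Suc[OF lim_1_over_n])
  ultimately show ?thesis
    unfolding contingent_cone_def
    by (auto intro!: exI[of _ "\<lambda>n. 1 / real (Suc n)"] exI[of _ "\<lambda>_. y - x"])
qed

lemma convex_on_sum_fun:
  assumes "\<And>i. i \<in> I \<Longrightarrow> convex_on UNIV (F i)"
  shows "convex_on UNIV (\<lambda>x. \<Sum>i\<in>I. F i x)"
  using assms
proof (induction I rule: infinite_finite_induct)
  case (insert i I)
  then have "convex_on UNIV (\<lambda>x. F i x + (\<Sum>i\<in>I. F i x))" by (intro convex_on_add) auto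
  then show ?case using insert by simp
qed (simp_all add: convex_on_def)

text \<open>At a maximiser for the intermediate point, convexity of that single function
  suffices.\<close>

lemma convex_on_maxF:
  assumes W: "compact W" "W \<noteq> {}" and cont: "\<And>x. continuous_on W (f x)"
    and conv: "\<And>w. w \<in> W \<Longrightarrow> convex_on UNIV (\<lambda>x. f x w)"
  shows "convex_on UNIV (maxF f W)"
proof (rule convex_onI)
  fix t :: real and x y assume t: "0 < t" "t < 1"
  obtain w where w: "w \<in> W" "f ((1 - t) *\<^sub>R x + t *\<^sub>R y) w = maxF f W ((1 - t) *\<^sub>R x + t *\<^sub>R y)"
    using maxF_attained[of W f "(1 - t) *\<^sub>R x + t *\<^sub>R y", OF W cont] by blast
  have "f ((1 - t) *\<^sub>R x + t *\<^sub>R y) w \<le> (1 - t) * f x w + t * f y w"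
    using convex_onD[OF conv[OF w(1)], of t x y] t by simp
  also have "\<dots> \<le> (1 - t) * maxF f W x + t * maxF f W y"
    using t by (intro add_mono mult_left_mono maxF_upper W cont w) auto
  finally show "maxF f W ((1 - t) *\<^sub>R x + t *\<^sub>R y) \<le> (1 - t) * maxF f W x + t * maxF f W y"
    using w by simp
qed simp

text \<open>The Lagrangian is convex, so its first-order condition at \<open>xs\<close> is a global
  one. Its constraint part vanishes at \<open>xs\<close> by complementarity and is nonpositive at
  every feasible point.\<close>

lemma disc_global_opt_of_multiplier:
  fixes f :: "'a::euclidean_space \<Rightarrow> 'w::topological_space \<Rightarrow> real" and b :: "'a \<Rightarrow> 'b::real_inner"
  assumes A: "convex A" and W: "compact W" "W \<noteq> {}" and cont: "\<And>x. continuous_on W (f x)"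
    and b0: "\<And>x. b x = 0"
    and f_conv: "\<And>w. w \<in> W \<Longrightarrow> convex_on UNIV (\<lambda>x. f x w)"
    and g_conv: "\<And>i j. (i,j) \<in> disc_idx I m \<Longrightarrow> convex_on UNIV (\<lambda>x. g i x (tt i j))"
    and feas: "disc_feasible A g I m tt b xs"
    and mult: "disc_lagrange_mult f W A g I m tt b xs lam \<nu>"
  shows "disc_global_opt f W A g I m tt b xs"
proof -
  let ?R = "\<lambda>x. \<Sum>(i,j)\<in>disc_idx I m. lam (i,j) * g i x (tt i j)"
  let ?L = "\<lambda>x. maxF f W x + ?R x + inner \<nu> (b x)"
  have lam: "0 \<le> lam q \<and> lam q * g (fst q) xs (tt (fst q) (snd q)) = 0" if "q \<in> disc_idx I m" for q
    using mult that by (auto simp: disc_lagrange_mult_def)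
  have R_conv: "convex_on UNIV ?R"
    unfolding split_beta using lam g_conv by (intro convex_on_sum_fun convex_on_cmul) auto
  have "convex_on UNIV (\<lambda>x. maxF f W x + ?R x)"
    by (intro convex_on_add convex_on_maxF W cont f_conv R_conv)
  then have L_conv: "convex_on UNIV ?L" by (simp add: b0)
  have "maxF f W xs \<le> maxF f W y" if y: "disc_feasible A g I m tt b y" for y
  proof -
    have "y - xs \<in> contingent_cone A xs"
      using A feas y by (intro diff_mem_contingent_cone) (auto simp: disc_feasible_def)
    then obtain D where "((\<lambda>t. (?L (xs + t *\<^sub>R (y - xs)) - ?L xs) / t) \<longlongrightarrow> D) (at_right 0)" "D \<ge> 0"
      using mult unfolding disc_lagrange_mult_def nonneg_dir_deriv_def by blast
    with convex_dir_deriv_le[OF L_conv, of xs y D] have "?L xs \<le> ?L y" by simp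
    moreover have "?R xs = 0" using lam by (intro sum.neutral) auto
    moreover have "?R y \<le> 0"
      using lam y by (intro sum_nonpos) (force simp: disc_feasible_def intro: mult_nonneg_nonpos)
    ultimately show ?thesis by (simp add: b0)
  qed
  then show ?thesis using feas by (simp add: disc_global_opt_def)
qed

section \<open>The three assertions about (SIP)\<close>

theorem theorem8:
  fixes A :: "'a::euclidean_space set"
    and W :: "'w::t2_space set"
    and f :: "'a \<Rightarrow> 'w \<Rightarrow> real" and fx :: "'a \<Rightarrow> 'w \<Rightarrow> 'a"
    and b :: "'a \<Rightarrow> 'b::euclidean_space" and Db :: "'a \<Rightarrow> 'a \<Rightarrow>\<^sub>L 'b"
    and T :: "'t::metric_space set" and l :: nat
    and g :: "nat \<Rightarrow> 'a \<Rightarrow> 't \<Rightarrow> real" and gx :: "nat \<Rightarrow> 'a \<Rightarrow> 't \<Rightarrow> 'a"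
    and xs :: 'a
  assumes A_closed: "closed A" and A_convex: "convex A" and A_ne: "A \<noteq> {}"
    and W_compact: "compact W" and W_ne: "W \<noteq> {}"
    and f_cont: "continuous_on (UNIV \<times> W) (\<lambda>(x,w). f x w)"
    and f_deriv: "\<And>x w. w \<in> W \<Longrightarrow> ((\<lambda>x. f x w) has_derivative (\<lambda>h. inner (fx x w) h)) (at x)"
    and fx_cont: "continuous_on (UNIV \<times> W) (\<lambda>(x,w). fx x w)"
    and b_deriv: "\<And>x. (b has_derivative blinfun_apply (Db x)) (at x)"
    and Db_cont: "continuous_on UNIV Db"
    and T_compact: "compact T"
    and g_cont: "\<And>i. i \<in> {1..l} \<Longrightarrow> continuous_on (UNIV \<times> T) (\<lambda>(x,t). g i x t)"
    and g_deriv: "\<And>i x t. i \<in> {1..l} \<Longrightarrow> t \<in> T \<Longrightarrow>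
                    ((\<lambda>x. g i x t) has_derivative (\<lambda>h. inner (gx i x t) h)) (at x)"
    and gx_cont: "\<And>i. i \<in> {1..l} \<Longrightarrow> continuous_on (UNIV \<times> T) (\<lambda>(x,t). gx i x t)"
    and xs_feas: "sip_feasible A g l T b xs"
  shows
    "(sip_local_opt f W A g l T b xs \<and> sip_RCQ A g gx l T b Db xs \<longrightarrow>
        (\<exists>\<mu> \<nu>. sip_discrete_lagrange_mult f W A g l T b xs \<mu> \<nu>))
     \<and>
     ((\<exists>\<mu> \<nu>. sip_discrete_lagrange_mult f W A g l T b xs \<mu> \<nu>) \<longleftrightarrow>
        (\<exists>m tt. disc_choice DIM('a) g l T xs m tt \<and>
           (\<exists>lam \<nu>. disc_lagrange_mult f W A g (active_idx g l T xs) m tt b xs lam \<nu>)))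
     \<and>
     ((\<forall>x. b x = 0) \<and> (\<forall>w\<in>W. convex_on UNIV (\<lambda>x. f x w)) \<and>
      (\<forall>i\<in>{1..l}. \<forall>t\<in>T. convex_on UNIV (\<lambda>x. g i x t)) \<and>
      (\<exists>x0\<in>A. \<forall>i\<in>{1..l}. \<forall>t\<in>T. g i x0 t < 0) \<longrightarrow>
        ((\<exists>\<mu> \<nu>. sip_discrete_lagrange_mult f W A g l T b xs \<mu> \<nu>) \<longleftrightarrow>
           sip_global_opt f W A g l T b xs)
        \<and>
        (sip_global_opt f W A g l T b xs \<longleftrightarrow>
           (\<exists>m tt. disc_choice DIM('a) g l T xs m tt \<and>
              disc_global_opt f W A g (active_idx g l T xs) m tt b xs)))"
proof -
  note g_cont_x = continuous_on_section[OF g_cont]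
  note f_cont_x = continuous_on_section[OF f_cont]
  let ?I = "active_idx g l T xs"
  have xs: "xs \<in> A" "b xs = 0" "\<And>i t. i \<in> {1..l} \<Longrightarrow> t \<in> T \<Longrightarrow> g i xs t \<le> 0"
    using xs_feas by (auto simp: sip_feasible_def)
  have iff: "(\<exists>\<mu> \<nu>. sip_discrete_lagrange_mult f W A g l T b xs \<mu> \<nu>) \<longleftrightarrow>
      (\<exists>m tt. disc_choice DIM('a) g l T xs m tt \<and>
        (\<exists>lam \<nu>. disc_lagrange_mult f W A g ?I m tt b xs lam \<nu>))"
    using sip_multiplier_of_disc_multiplier[of l T g xs _ _ f W A b, OF g_cont_x]
      disc_multiplier_of_sip_multiplier[of l T g A b xs f W, OF g_cont_x xs_feas] by blast
  have part1: "\<exists>\<mu> \<nu>. sip_discrete_lagrange_mult f W A g l T b xs \<mu> \<nu>"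
    if opt: "sip_local_opt f W A g l T b xs" and rcq: "sip_RCQ A g gx l T b Db xs"
  proof -
    obtain e where e: "e > 0" and rcq_e: "\<And>(y :: nat \<Rightarrow> 't \<Rightarrow> real) (z :: 'b).
        (\<forall>i\<in>{1..l}. continuous_on T (y i) \<and> (\<forall>t\<in>T. \<bar>y i t\<bar> < e)) \<and> norm z < e \<Longrightarrow>
        (\<exists>a\<in>A. (\<forall>i\<in>{1..l}. \<forall>t\<in>T. g i xs t + inner (gx i xs t) (a - xs) - y i t \<le> 0) \<and>
               b xs + blinfun_apply (Db xs) (a - xs) = z)"
      using rcq unfolding sip_RCQ_def by blast
    \<comment> \<open>The perturbation y = 0 in RCQ leaves the statement that the derivative of
      \<open>b\<close> maps \<open>A - xs\<close> onto a neighbourhood of 0.\<close>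
    have surj: "\<exists>k. xs + k \<in> A \<and> blinfun_apply (Db xs) k = z" if nz: "norm z < e" for z
    proof -
      obtain a where "a \<in> A" "b xs + blinfun_apply (Db xs) (a - xs) = z"
        using rcq_e[of "\<lambda>_ _. 0" z] nz e by auto
      then show ?thesis using xs by (intro exI[of _ "a - xs"]) simp
    qed
    \<comment> \<open>The constant perturbation \<open>- (e / 2)\<close> with z = 0 gives a
      direction \<open>a - xs\<close> in the kernel of the derivative of \<open>b\<close> that
      satisfies the linearised inequalities with slack \<open>e / 2\<close>.\<close>
    obtain a where a: "a \<in> A" "blinfun_apply (Db xs) (a - xs) = 0"
      "\<forall>i\<in>{1..l}. \<forall>t\<in>T. g i xs t + inner (gx i xs t) (a - xs) - (- (e / 2)) \<le> 0"
      using rcq_e[of "\<lambda>_ _. - (e / 2)" 0] e xs(2) by auto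
    have b_cont: "continuous_on UNIV b"
      using b_deriv has_derivative_continuous by (force simp: continuous_on_eq_continuous_within)
    have "\<exists>m tt lam \<nu>. disc_choice DIM('a) g l T xs m tt \<and> disc_lagrange_mult f W A g ?I m tt b xs lam \<nu>"
    proof (rule disc_multiplier_of_local_opt[OF A_closed A_convex W_compact W_ne f_cont f_deriv fx_cont
          b_deriv T_compact g_cont g_deriv gx_cont opt])
      show "\<exists>\<delta>>0. \<forall>t. 0 < t \<and> t < \<delta> \<longrightarrow>
        (\<exists>y. norm y \<le> \<eta> * t \<and> xs + t *\<^sub>R h + y \<in> A \<and> b (xs + t *\<^sub>R h + y) = 0)"
        if h: "xs + h \<in> A" "blinfun_apply (Db xs) h = 0" "\<eta> > 0" for h \<eta>
      proof -
        obtain \<delta> where "\<delta> > 0" "\<And>t. 0 < t \<Longrightarrow> t < \<delta> \<Longrightarrow>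
            \<exists>y. norm y \<le> \<eta> * t \<and> xs + t *\<^sub>R h + y \<in> A \<and> b (xs + t *\<^sub>R h + y) = 0"
          by (rule equality_restoration[OF A_convex xs(1) b_cont b_deriv xs(2) e surj h]) (assumption, rule that)
        then show ?thesis by (intro exI[of _ \<delta>]) auto
      qed
      show "closed (multiplier_cone {h. xs + h \<in> A} (blinfun_apply (Db xs)))"
        using e surj by (intro closed_multiplier_cone) auto
      show "g i xs t + inner (gx i xs t) (a - xs) < 0" if "i \<in> {1..l}" "t \<in> T" for i t
        using a(3) that e by fastforce
    qed (use a in auto)
    then show ?thesis using iff by blast
  qed
  have part3: "((\<exists>\<mu> \<nu>. sip_discrete_lagrange_mult f W A g l T b xs \<mu> \<nu>) \<longleftrightarrow> sip_global_opt f W A g l T b xs) \<and>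
      (sip_global_opt f W A g l T b xs \<longleftrightarrow>
        (\<exists>m tt. disc_choice DIM('a) g l T xs m tt \<and> disc_global_opt f W A g ?I m tt b xs))"
    if b0: "\<forall>x. b x = 0" and f_conv: "\<forall>w\<in>W. convex_on UNIV (\<lambda>x. f x w)"
      and g_conv: "\<forall>i\<in>{1..l}. \<forall>t\<in>T. convex_on UNIV (\<lambda>x. g i x t)"
      and slater: "\<exists>x0\<in>A. \<forall>i\<in>{1..l}. \<forall>t\<in>T. g i x0 t < 0"
  proof -
    have mult_imp_disc: "disc_global_opt f W A g ?I m tt b xs"
      if choice: "disc_choice DIM('a) g l T xs m tt" and mult: "disc_lagrange_mult f W A g ?I m tt b xs lam \<nu>"
      for m tt lam \<nu>
    proof (rule disc_global_opt_of_multiplier[OF A_convex W_compact W_ne f_cont_x _ _ _ _ mult])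
      have il: "i \<in> {1..l}" "tt i j \<in> T" if "(i,j) \<in> disc_idx ?I m" for i j
        using that choice by (auto simp: disc_idx_def disc_choice_def active_idx_def active_pts_def)
      show "convex_on UNIV (\<lambda>x. g i x (tt i j))" if "(i,j) \<in> disc_idx ?I m" for i j
        using g_conv il[OF that] by blast
      show "disc_feasible A g ?I m tt b xs"
        using xs il by (auto simp: disc_feasible_def)
    qed (use b0 f_conv in auto)
    have disc_imp_sip: "sip_global_opt f W A g l T b xs"
      if choice: "disc_choice DIM('a) g l T xs m tt" and disc: "disc_global_opt f W A g ?I m tt b xs" for m tt
    proof -
      \<comment> \<open>(D) imposes only part of the constraints of (SIP), so its feasible set is
        larger and optimality over it is inherited.\<close>
      have "disc_feasible A g ?I m tt b x" if "sip_feasible A g l T b x" for x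
        using that choice
        by (auto simp: disc_feasible_def sip_feasible_def disc_idx_def disc_choice_def active_idx_def active_pts_def)
      then show ?thesis using disc xs_feas by (auto simp: sip_global_opt_def disc_global_opt_def)
    qed
    have sip_imp_mult: "\<exists>m tt lam \<nu>. disc_choice DIM('a) g l T xs m tt \<and> disc_lagrange_mult f W A g ?I m tt b xs lam \<nu>"
      if opt: "sip_global_opt f W A g l T b xs"
    proof -
      obtain x0 where x0: "x0 \<in> A" "\<And>i t. i \<in> {1..l} \<Longrightarrow> t \<in> T \<Longrightarrow> g i x0 t < 0"
        using slater by blast
      have b_eq: "b = (\<lambda>_. 0)" using b0 by auto
      show ?thesis
      proof (rule disc_multiplier_of_local_opt[OF A_closed A_convex W_compact W_ne f_cont f_deriv fx_cont
            _ T_compact g_cont g_deriv gx_cont, where B = "\<lambda>_. 0 :: 'b" and k = "x0 - xs"])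
        show "(b has_derivative (\<lambda>_. 0)) (at xs)" by (simp add: b_eq)
        show "sip_local_opt f W A g l T b xs"
          using opt by (auto simp: sip_local_opt_def sip_global_opt_def intro: exI[of _ 1])
        show "closed (multiplier_cone {h. xs + h \<in> A} (\<lambda>_. 0 :: 'b))" by (rule closed_multiplier_cone_zero)
        show "xs + (x0 - xs) \<in> A" using x0 by simp
        \<comment> \<open>As b = 0 holds everywhere, no correction is required: y = 0 works, and
          convexity of \<open>A\<close> keeps the segment inside.\<close>
        show "\<exists>\<delta>>0. \<forall>t. 0 < t \<and> t < \<delta> \<longrightarrow>
          (\<exists>y. norm y \<le> \<eta> * t \<and> xs + t *\<^sub>R h + y \<in> A \<and> b (xs + t *\<^sub>R h + y) = 0)"
          if h: "xs + h \<in> A" and \<eta>: "\<eta> > 0" for h \<eta>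
        proof (intro exI[of _ 1] conjI allI impI)
          fix t :: real assume t: "0 < t \<and> t < 1"
          have "(1 - t) *\<^sub>R xs + t *\<^sub>R (xs + h) \<in> A"
            using A_convex xs h t by (intro convexD) auto
          then show "\<exists>y. norm y \<le> \<eta> * t \<and> xs + t *\<^sub>R h + y \<in> A \<and> b (xs + t *\<^sub>R h + y) = 0"
            using t \<eta> b0 by (intro exI[of _ 0]) (auto simp: algebra_simps)
        qed simp
        \<comment> \<open>The gradient inequality turns the Slater point \<open>x0\<close> into the
          Slater direction \<open>x0 - xs\<close> of the linearised system.\<close>
        show "g i xs t + inner (gx i xs t) (x0 - xs) < 0" if "i \<in> {1..l}" "t \<in> T" for i t
        proof -
          have "convex_on UNIV (\<lambda>x. g i x t)" using g_conv that by blast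
          then have "inner (gx i xs t) (x0 - xs) \<le> g i x0 t - g i xs t"
            by (rule convex_dir_deriv_le) (rule has_derivative_dir_quotient[OF g_deriv[OF that]])
          then show ?thesis using x0(2)[OF that] by simp
        qed
      qed simp_all
    qed
    \<comment> \<open>The implications form a cycle: a multiplier makes \<open>xs\<close> optimal
      for (D), hence for (SIP), which in turn yields a multiplier.\<close>
    show ?thesis using iff mult_imp_disc disc_imp_sip sip_imp_mult by blast
  qed
  show ?thesis using part1 iff part3 by blast
qed

end
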